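(* Let $\alpha_k\ge0$, $k\in\mathbb{N}_0$, with $K=\sum_{k=1}^\infty\alpha_k<1$, and let $(X_n)_{n\in\mathbb{Z}}$ be the stationary INAR($\infty$) process with immigration parameter $\alpha_0$ and reproduction coefficients $\alpha_k$, $k\in\mathbb{N}$. Then $$u_n:=X_n-\sum_{k=1}^\infty\alpha_kX_{n-k}-\alpha_0,\qquad n\in\mathbb{Z},$$ defines a stationary sequence $(u_n)$ with $\mathbb{E}u_n=0$ for all $n\in\mathbb{Z}$ and $$\mathbb{E}[u_nu_{n'}]=\begin{cases}0,& n\ne n',\\ \frac{\alpha_0}{1-K},& n=n'.\end{cases}$$ Furthermore, with $\mu_X:=\mathbb{E}X_0=\alpha_0/(1-K)$, $$(X_n-\mu_X)-\sum_{k=1}^\infty\alpha_k(X_{n-k}-\mu_X)=u_n,\qquad n\in\mathbb{Z}.$$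
   Context: INAR($\infty$): Given $\alpha_k\ge0$ ($k\in\mathbb{N}_0$) with $K=\sum_{k\ge1}\alpha_k<1$, let $\varepsilon_n$, $n\in\mathbb{Z}$, be i.i.d. $\mathrm{Pois}(\alpha_0)$ and $\xi^{(n,k)}_l\sim\mathrm{Pois}(\alpha_k)$ independently over $n\in\mathbb{Z}$, $k,l\in\mathbb{N}$ and independent of $(\varepsilon_n)$. The INAR($\infty$) process with immigration parameter $\alpha_0$ and reproduction coefficients $\alpha_k$, $k\in\mathbb{N}$, is the almost surely unique (strictly) stationary $\mathbb{N}_0$-valued solution $(X_n)_{n\in\mathbb{Z}}$ of $X_n=\varepsilon_n+\sum_{k=1}^\infty\sum_{l=1}^{X_{n-k}}\xi^{(n,k)}_l$, $n\in\mathbb{Z}$, where $\varepsilon_n$ and $(\xi^{(n,k)}_l)_{k,l}$ are independent of $X_{n-1},X_{n-2},\dots$. It satisfies $\mathbb{E}X_n=\alpha_0/(1-K)$. "Stationary" means strictly stationary. *)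

theory Defs
  imports "HOL-Probability.Probability"
begin

text \<open>The library's \<open>poisson_pmf\<close> is only specified for positive rates;
  \<open>Pois(0)\<close> is the point mass at \<open>0\<close>.\<close>

definition pois :: "real \<Rightarrow> nat pmf" where
  "pois r = (if r = 0 then return_pmf 0 else poisson_pmf r)"

text \<open>Strict stationarity: every time shift of the process has the same law on path space
  (product \<open>\<sigma>\<close>-algebra).\<close>

definition strictly_stationary :: "'a measure \<Rightarrow> 'b measure \<Rightarrow> (int \<Rightarrow> 'a \<Rightarrow> 'b) \<Rightarrow> bool" where
  "strictly_stationary M S X \<longleftrightarrow>
     (\<forall>n. X n \<in> measurable M S) \<and>
     (\<forall>h. distr M (\<Pi>\<^sub>M n\<in>UNIV. S) (\<lambda>\<omega> n. X (n + h) \<omega>) =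
          distr M (\<Pi>\<^sub>M n\<in>UNIV. S) (\<lambda>\<omega> n. X n \<omega>))"

text \<open>\<open>\<xi> n k l\<close> stands for \<open>\<xi>\<^sup>(\<^sup>n\<^sup>,\<^sup>k\<^sup>)\<^sub>l\<close> and is only constrained for
  \<open>k, l \<ge> 1\<close>. Mutual independence of the whole family is expressed over a disjoint sum of
  index sets.\<close>

definition INAR_innovations ::
    "'a measure \<Rightarrow> (nat \<Rightarrow> real) \<Rightarrow> (int \<Rightarrow> 'a \<Rightarrow> nat) \<Rightarrow> (int \<Rightarrow> nat \<Rightarrow> nat \<Rightarrow> 'a \<Rightarrow> nat) \<Rightarrow> bool" where
  "INAR_innovations M \<alpha> \<epsilon> \<xi> \<longleftrightarrow>
     prob_space.indep_vars M (\<lambda>_. count_space UNIV)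
       (case_sum \<epsilon> (\<lambda>(n, k, l). \<xi> n k l)) (UNIV <+> (UNIV \<times> {1..} \<times> {1..})) \<and>
     (\<forall>n. distr M (count_space UNIV) (\<epsilon> n) = measure_pmf (pois (\<alpha> 0))) \<and>
     (\<forall>n. \<forall>k\<ge>1. \<forall>l\<ge>1. distr M (count_space UNIV) (\<xi> n k l) = measure_pmf (pois (\<alpha> k)))"

text \<open>Stationary solutions of \<open>X\<^sub>n = \<epsilon>\<^sub>n + (\<Sum>k\<ge>1. \<Sum>l=1..X\<^sub>n\<^sub>-\<^sub>k. \<xi>\<^sup>(\<^sup>n\<^sup>,\<^sup>k\<^sup>)\<^sub>l)\<close>. Series over
  \<open>k \<ge> 1\<close> are indexed by \<open>k = Suc j\<close>; summability in the discrete type \<open>nat\<close> says that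
  all but finitely many terms vanish, i.e. that the series is finite. The last conjunct: for every
  \<open>n\<close>, the pair of \<open>\<epsilon>\<^sub>n\<close> and the family of all \<open>\<xi>\<^sup>(\<^sup>n\<^sup>,\<^sup>k\<^sup>)\<^sub>l\<close> is
  independent of the past of \<open>X\<close> strictly before \<open>n\<close> (independence of the generated
  \<open>\<sigma>\<close>-algebras).\<close>

definition INAR_stationary_solution ::
    "'a measure \<Rightarrow> (int \<Rightarrow> 'a \<Rightarrow> nat) \<Rightarrow> (int \<Rightarrow> nat \<Rightarrow> nat \<Rightarrow> 'a \<Rightarrow> nat) \<Rightarrow> (int \<Rightarrow> 'a \<Rightarrow> nat) \<Rightarrow> bool" where
  "INAR_stationary_solution M \<epsilon> \<xi> X \<longleftrightarrow>
     strictly_stationary M (count_space UNIV) X \<and>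
     (\<forall>n. AE \<omega> in M.
        summable (\<lambda>j. \<Sum>l=1..X (n - int (Suc j)) \<omega>. \<xi> n (Suc j) l \<omega>) \<and>
        X n \<omega> = \<epsilon> n \<omega> + (\<Sum>j. \<Sum>l=1..X (n - int (Suc j)) \<omega>. \<xi> n (Suc j) l \<omega>)) \<and>
     (\<forall>n. prob_space.indep_set M
        (sets (vimage_algebra (space M)
          (\<lambda>\<omega>. (\<epsilon> n \<omega>, \<lambda>kl\<in>{1..} \<times> {1..}. \<xi> n (fst kl) (snd kl) \<omega>))
          (count_space UNIV \<Otimes>\<^sub>M (\<Pi>\<^sub>M kl\<in>{1..} \<times> {1..}. count_space UNIV))))
        (sets (vimage_algebra (space M)
          (\<lambda>\<omega>. \<lambda>m\<in>{..<n}. X m \<omega>)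
          (\<Pi>\<^sub>M m\<in>{..<n}. count_space UNIV))))"

text \<open>The INAR(\<open>\<infinity>\<close>) process driven by \<open>(\<epsilon>, \<xi>)\<close> is \<^emph>\<open>the\<close> almost surely unique stationary
  solution.\<close>

definition INAR_process ::
    "'a measure \<Rightarrow> (nat \<Rightarrow> real) \<Rightarrow> (int \<Rightarrow> 'a \<Rightarrow> nat) \<Rightarrow> (int \<Rightarrow> nat \<Rightarrow> nat \<Rightarrow> 'a \<Rightarrow> nat) \<Rightarrow>
      (int \<Rightarrow> 'a \<Rightarrow> nat) \<Rightarrow> bool" where
  "INAR_process M \<alpha> \<epsilon> \<xi> X \<longleftrightarrow>
     INAR_innovations M \<alpha> \<epsilon> \<xi> \<and>
     INAR_stationary_solution M \<epsilon> \<xi> X \<and>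
     (\<forall>X'. INAR_stationary_solution M \<epsilon> \<xi> X' \<longrightarrow> (AE \<omega> in M. \<forall>n. X' n \<omega> = X n \<omega>))"

definition INAR_residual :: "(nat \<Rightarrow> real) \<Rightarrow> (int \<Rightarrow> 'a \<Rightarrow> nat) \<Rightarrow> int \<Rightarrow> 'a \<Rightarrow> real" where
  "INAR_residual \<alpha> X n \<omega> =
     real (X n \<omega>) - (\<Sum>j. \<alpha> (Suc j) * real (X (n - int (Suc j)) \<omega>)) - \<alpha> 0"

end

theory Submission
  imports Defs
begin

text \<open>
  A stationary solution need not have a finite mean for any obvious reason, so the mean is not read
  off the equation at once. The Picard iterates of the recursion started at \<open>0\<close> increase, and their
  means stay below \<open>\<alpha>\<^sub>0 / (1 - K)\<close>; their supremum is therefore a stationary solution with finite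
  mean, and almost sure uniqueness identifies it with \<open>X\<close>. Taking expectations in the equation then
  gives \<open>\<mu> = \<alpha>\<^sub>0 + K \<mu>\<close>.

  Second moments of \<open>X\<close> are not needed: \<open>u\<^sub>n\<close> is the sum of the pairwise orthogonal variables
  \<open>\<epsilon>\<^sub>n - \<alpha>\<^sub>0\<close> and \<open>(\<xi>\<^sup>(\<^sup>n\<^sup>,\<^sup>k\<^sup>)\<^sub>l - \<alpha>\<^sub>k) 1[l \<le> X\<^sub>n\<^sub>-\<^sub>k]\<close>, whose squared norms \<open>\<alpha>\<^sub>0\<close> and
  \<open>\<alpha>\<^sub>k P(X\<^sub>n\<^sub>-\<^sub>k \<ge> l)\<close> add up to \<open>\<alpha>\<^sub>0 + K \<mu> = \<mu>\<close>, and each of which is orthogonal to every square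
  integrable function of the past of \<open>X\<close>.
\<close>

subsection \<open>Poisson moments, independence and orthogonal series\<close>

text \<open>Why the mean cannot come from the equation alone: in \<open>ennreal\<close> the relation
  \<open>m = \<alpha> 0 + K * m\<close> is also satisfied by infinity as soon as
  \<open>K > 0\<close>, so finiteness needs a separate source. For the supremum of the iterates to
  qualify as a stationary solution, two structural facts are needed besides the fixed point
  property. Its value at time \<open>n\<close> depends on innovations at times up to
  \<open>n\<close> only, which makes later noise independent of it; and it commutes with time
  shifts, so that shift invariance of the law of the innovations becomes strict stationarity. The
  residual is reached as an almost sure limit along finite boxes of terms, while orthogonality lives
  in L2. Fatou's lemma joins the two: the squared norms of the remainders are bounded by tails of
  the convergent series of squared norms. Each \<open>u m\<close> with \<open>m < n\<close> is then
  itself a square integrable function of the past of \<open>n\<close>, and this yields the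
  covariances.\<close>

lemma has_bochner_integral_nat_pmf:
  fixes p :: "nat pmf" and f :: "nat \<Rightarrow> real"
  assumes "(\<lambda>k. pmf p k * f k) sums s" "\<And>k. f k \<ge> 0"
  shows "has_bochner_integral (measure_pmf p) f s"
proof -
  have abs: "summable (\<lambda>k. norm (pmf p k * f k))"
    using assms by (simp add: sums_iff)
  have "has_bochner_integral (count_space UNIV) (\<lambda>k. pmf p k * f k) s"
    using assms abs
    by (simp add: has_bochner_integral_iff integrable_count_space_nat_iff integral_count_space_nat sums_iff)
  then show ?thesis
    unfolding measure_pmf_eq_density
    by (intro has_bochner_integral_density) auto
qed

text \<open>The factor \<open>k\<close> cancels against the factorial and the term at
  \<open>0\<close> vanishes. This is the identity \<open>E[N g(N)] = r E[g(N + 1)]\<close> for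
  Poisson \<open>N\<close>, which yields the factorial moments one after another.\<close>

lemma poisson_weights_shift:
  fixes g :: "nat \<Rightarrow> real"
  assumes "(\<lambda>k. r ^ k / fact k * exp (-r) * g (Suc k)) sums s"
  shows "(\<lambda>k. r ^ k / fact k * exp (-r) * (real k * g k)) sums (r * s)"
proof -
  have "(\<lambda>k. r ^ Suc k / fact (Suc k) * exp (-r) * (real (Suc k) * g (Suc k))) sums (r * s)"
    using sums_mult[OF assms, of r] by (simp add: field_simps del: of_nat_Suc)
  then show ?thesis
    by (subst (asm) sums_Suc_iff) simp
qed

lemma pois_moments:
  assumes "r \<ge> 0"
  shows has_bochner_integral_pois: "has_bochner_integral (measure_pmf (pois r)) real r"
    and has_bochner_integral_pois_variance:
      "has_bochner_integral (measure_pmf (pois r)) (\<lambda>k. (real k - r)\<^sup>2) r"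
proof -
  let ?w = "\<lambda>k. r ^ k / fact k * exp (-r)"
  \<comment> \<open>Rate \<open>0\<close> is covered as well: \<open>0 ^ 0 = 1\<close> leaves mass
    one at \<open>0\<close>.\<close>
  have w: "pmf (pois r) k = ?w k" for k
    using assms by (cases "k = 0") (auto simp: pois_def indicator_def)
  have s0: "?w sums 1"
    using sums_mult2[OF exp_converges[of r], of "exp (-r)"]
    by (simp add: divide_inverse mult.commute exp_minus_inverse)
  have s1: "(\<lambda>k. ?w k * real k) sums r"
    using poisson_weights_shift[of r "\<lambda>_. 1" 1] s0 by simp
  have s2: "(\<lambda>k. ?w k * (real k * (real k - 1))) sums (r * r)"
    using poisson_weights_shift[of r "\<lambda>k. real k - 1" r] s1 by simp
  show "has_bochner_integral (measure_pmf (pois r)) real r"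
    by (rule has_bochner_integral_nat_pmf) (use s1 in \<open>simp_all add: w\<close>)
  \<comment> \<open>The square is expanded in factorial moments:
    \<open>(k - r)\<^sup>2 = k * (k - 1) + (1 - 2 * r) * k + r\<^sup>2\<close>.\<close>
  have "(\<lambda>k. ?w k * (real k * (real k - 1)) + (1 - 2 * r) * (?w k * real k) + r\<^sup>2 * ?w k)
      sums (r * r + (1 - 2 * r) * r + r\<^sup>2 * 1)"
    by (intro sums_add sums_mult s0 s1 s2)
  also have "(\<lambda>k. ?w k * (real k * (real k - 1)) + (1 - 2 * r) * (?w k * real k) + r\<^sup>2 * ?w k)
      = (\<lambda>k. pmf (pois r) k * (real k - r)\<^sup>2)"
    unfolding w by (rule ext) (simp only: power2_eq_square, algebra)
  also have "r * r + (1 - 2 * r) * r + r\<^sup>2 * 1 = r"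
    by (simp add: power2_eq_square algebra_simps)
  finally show "has_bochner_integral (measure_pmf (pois r)) (\<lambda>k. (real k - r)\<^sup>2) r"
    by (intro has_bochner_integral_nat_pmf) simp_all
qed

section \<open>Independence and stationarity under measurable maps\<close>

lemma (in prob_space) indep_var_nn_integral:
  fixes f g :: "'a \<Rightarrow> ennreal"
  assumes "indep_var borel f borel g"
  shows "(\<integral>\<^sup>+\<omega>. f \<omega> * g \<omega> \<partial>M) = (\<integral>\<^sup>+\<omega>. f \<omega> \<partial>M) * (\<integral>\<^sup>+\<omega>. g \<omega> \<partial>M)"
proof -
  have "indep_vars (\<lambda>_. borel) (case_bool f g) UNIV"
    using assms unfolding indep_var_def
    by (rule indep_vars_cong[THEN iffD1, rotated -1]) (auto split: bool.split)
  from indep_vars_nn_integral[OF _ this] show ?thesis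
    by (simp add: UNIV_bool mult.commute)
qed

lemma (in prob_space) indep_vars_imp_indep_var:
  assumes "indep_vars N X I" "i \<in> I" "j \<in> I" "i \<noteq> j"
  shows "indep_var (N i) (X i) (N j) (X j)"
proof -
  have "indep_var (PiM {i} N) (\<lambda>\<omega>. restrict (\<lambda>i. X i \<omega>) {i}) (PiM {j} N) (\<lambda>\<omega>. restrict (\<lambda>i. X i \<omega>) {j})"
    using assms by (intro indep_var_restrict) auto
  from indep_var_compose[OF this, of "\<lambda>f. f i" "N i" "\<lambda>f. f j" "N j"] show ?thesis
    by (simp add: comp_def)
qed

text \<open>The path of \<open>Y\<close> shifted by \<open>h\<close> is the image of
  \<open>e h\<close> under one map that does not depend on \<open>h\<close>, so equal laws of all
  \<open>e h\<close> are pushed forward to equal laws of the shifts.\<close>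

lemma strictly_stationary_factor:
  assumes law: "\<And>h. distr M N (e h) = distr M N (e 0)"
    and e: "\<And>h. e h \<in> measurable M N"
    and F: "\<And>n. F n \<in> measurable N S"
    and Y: "\<And>n h \<omega>. Y (n + h) \<omega> = F n (e h \<omega>)"
  shows "strictly_stationary M S Y"
proof -
  note [measurable] = e F
  have *: "distr M (\<Pi>\<^sub>M n\<in>UNIV. S) (\<lambda>\<omega> n. Y (n + h) \<omega>)
      = distr (distr M N (e h)) (\<Pi>\<^sub>M n\<in>UNIV. S) (\<lambda>x n. F n x)" for h
    by (subst distr_distr)
       (auto simp: comp_def Y intro!: measurable_PiM_single' dest: measurable_space[OF F])
  have "distr M (\<Pi>\<^sub>M n\<in>UNIV. S) (\<lambda>\<omega> n. Y (n + h) \<omega>) = distr M (\<Pi>\<^sub>M n\<in>UNIV. S) (\<lambda>\<omega> n. Y n \<omega>)" for h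
    using *[of h] *[of 0] law[of h] by simp
  moreover have "Y n \<in> measurable M S" for n
  proof -
    have "Y n = (\<lambda>\<omega>. F n (e 0 \<omega>))" using Y[of n 0] by auto
    then show ?thesis by simp
  qed
  ultimately show ?thesis unfolding strictly_stationary_def by blast
qed

section \<open>Square integrable functions and orthogonal series\<close>

lemma (in finite_measure) square_integrable_imp_integrable_mult:
  fixes f g :: "'a \<Rightarrow> real"
  assumes [measurable]: "f \<in> borel_measurable M" "g \<in> borel_measurable M"
    and "integrable M (\<lambda>x. (f x)\<^sup>2)" "integrable M (\<lambda>x. (g x)\<^sup>2)"
  shows "integrable M (\<lambda>x. f x * g x)"
proof (rule Bochner_Integration.integrable_bound)
  show "integrable M (\<lambda>x. (f x)\<^sup>2 + (g x)\<^sup>2)" using assms by simp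
  have "\<bar>f x * g x\<bar> \<le> (f x)\<^sup>2 + (g x)\<^sup>2" for x
  proof -
    have "2 * (\<bar>f x\<bar> * \<bar>g x\<bar>) \<le> (f x)\<^sup>2 + (g x)\<^sup>2"
      using sum_squares_bound[of "\<bar>f x\<bar>" "\<bar>g x\<bar>"] by simp
    moreover have "0 \<le> \<bar>f x\<bar> * \<bar>g x\<bar>" by simp
    ultimately show ?thesis unfolding abs_mult by linarith
  qed
  then show "AE x in M. norm (f x * g x) \<le> norm ((f x)\<^sup>2 + (g x)\<^sup>2)"
    by auto
qed simp

lemma (in finite_measure) integral_cauchy_schwarz:
  fixes f g :: "'a \<Rightarrow> real"
  assumes [measurable]: "f \<in> borel_measurable M" "g \<in> borel_measurable M"
    and f: "integrable M (\<lambda>x. (f x)\<^sup>2)" and g: "integrable M (\<lambda>x. (g x)\<^sup>2)"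
  shows "(\<integral>x. f x * g x \<partial>M)\<^sup>2 \<le> (\<integral>x. (f x)\<^sup>2 \<partial>M) * (\<integral>x. (g x)\<^sup>2 \<partial>M)"
proof -
  let ?a = "\<integral>x. (f x)\<^sup>2 \<partial>M" and ?b = "\<integral>x. (g x)\<^sup>2 \<partial>M" and ?c = "\<integral>x. f x * g x \<partial>M"
  have fg: "integrable M (\<lambda>x. f x * g x)"
    by (intro square_integrable_imp_integrable_mult f g) auto
  have quad: "0 \<le> ?a - 2 * t * ?c + t\<^sup>2 * ?b" for t
  proof -
    have "0 \<le> (\<integral>x. (f x - t * g x)\<^sup>2 \<partial>M)" by simp
    also have "\<dots> = (\<integral>x. (f x)\<^sup>2 - (2 * t) * (f x * g x) + t\<^sup>2 * (g x)\<^sup>2 \<partial>M)"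
      by (rule Bochner_Integration.integral_cong) (auto simp: power2_eq_square algebra_simps)
    finally show ?thesis by (simp add: f g fg)
  qed
  show ?thesis
  proof (cases "?b = 0")
    case True
    have "?c = 0"
    proof (rule ccontr)
      assume "?c \<noteq> 0"
      \<comment> \<open>For \<open>?b = 0\<close> the form is affine in \<open>t\<close>, and this
        \<open>t\<close> gives it the value \<open>-1\<close>.\<close>
      with quad[of "(?a + 1) / (2 * ?c)"] True show False by simp
    qed
    with True show ?thesis by simp
  next
    case False
    then have "?b > 0" by (simp add: less_le)
    \<comment> \<open>The minimiser of the quadratic form.\<close>
    with quad[of "?c / ?b"] show ?thesis by (simp add: field_simps power2_eq_square)
  qed
qed

text \<open>Almost sure convergence identifies the limit, convergence of the squared norms controls
  the increments, and together they give convergence of the partial sums to \<open>U\<close> in L2.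
  Norms and inner products then pass to the limit.\<close>

lemma (in prob_space) orthogonal_series:
  fixes Z :: "'i \<Rightarrow> 'a \<Rightarrow> real" and A :: "nat \<Rightarrow> 'i set"
  assumes Z: "\<And>i. Z i \<in> borel_measurable M" "\<And>i. integrable M (\<lambda>\<omega>. (Z i \<omega>)\<^sup>2)"
    and orth: "\<And>i j. i \<noteq> j \<Longrightarrow> expectation (\<lambda>\<omega>. Z i \<omega> * Z j \<omega>) = 0"
    and A: "\<And>n. finite (A n)" "incseq A"
    and s: "(\<lambda>n. \<Sum>i\<in>A n. expectation (\<lambda>\<omega>. (Z i \<omega>)\<^sup>2)) \<longlonglongrightarrow> s"
    and U: "U \<in> borel_measurable M" "AE \<omega> in M. (\<lambda>n. \<Sum>i\<in>A n. Z i \<omega>) \<longlonglongrightarrow> U \<omega>"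
  shows orthogonal_series_square_integrable: "integrable M (\<lambda>\<omega>. (U \<omega>)\<^sup>2)"
    and orthogonal_series_square: "expectation (\<lambda>\<omega>. (U \<omega>)\<^sup>2) = s"
    and orthogonal_series_inner: "\<And>V. V \<in> borel_measurable M \<Longrightarrow> integrable M (\<lambda>\<omega>. (V \<omega>)\<^sup>2) \<Longrightarrow>
      (\<And>i. expectation (\<lambda>\<omega>. Z i \<omega> * V \<omega>) = 0) \<Longrightarrow> expectation (\<lambda>\<omega>. U \<omega> * V \<omega>) = 0"
proof -
  note [measurable] = Z(1) U(1)
  define q where "q i = expectation (\<lambda>\<omega>. (Z i \<omega>)\<^sup>2)" for i
  define S where "S n \<omega> = (\<Sum>i\<in>A n. Z i \<omega>)" for n \<omega>
  have [measurable]: "S n \<in> borel_measurable M" for n unfolding S_def by simp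
  have intZ: "integrable M (\<lambda>\<omega>. Z i \<omega> * Z j \<omega>)" for i j
    by (intro square_integrable_imp_integrable_mult Z)
  have fin: "integrable M (\<lambda>\<omega>. (\<Sum>i\<in>B. Z i \<omega>)\<^sup>2) \<and> expectation (\<lambda>\<omega>. (\<Sum>i\<in>B. Z i \<omega>)\<^sup>2) = (\<Sum>i\<in>B. q i)"
    if "finite B" for B
  proof -
    have eq: "(\<Sum>i\<in>B. Z i \<omega>)\<^sup>2 = (\<Sum>i\<in>B. \<Sum>j\<in>B. Z i \<omega> * Z j \<omega>)" for \<omega>
      by (simp add: power2_eq_square sum_product)
    have "expectation (\<lambda>\<omega>. \<Sum>i\<in>B. \<Sum>j\<in>B. Z i \<omega> * Z j \<omega>)
        = (\<Sum>i\<in>B. \<Sum>j\<in>B. expectation (\<lambda>\<omega>. Z i \<omega> * Z j \<omega>))"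
      by (simp add: intZ)
    also have "\<dots> = (\<Sum>i\<in>B. \<Sum>j\<in>B. if j = i then q i else 0)"
      using orth by (intro sum.cong refl) (auto simp: q_def power2_eq_square)
    finally show ?thesis using that by (simp add: eq intZ)
  qed
  have sub: "S m \<omega> - S n \<omega> = (\<Sum>i\<in>A m - A n. Z i \<omega>)" if "n \<le> m" for m n \<omega>
    unfolding S_def using A that by (simp add: sum_diff incseqD)
  have qsub: "(\<Sum>i\<in>A m - A n. q i) = (\<Sum>i\<in>A m. q i) - (\<Sum>i\<in>A n. q i)" if "n \<le> m" for m n
    using A that by (simp add: sum_diff incseqD)
  have q0: "q i \<ge> 0" for i unfolding q_def by simp
  have s': "(\<lambda>n. \<Sum>i\<in>A n. q i) \<longlonglongrightarrow> s" using s unfolding q_def .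
  \<comment> \<open>Fatou's lemma in \<open>m\<close> with \<open>n\<close> fixed; by orthogonality
    the increment from \<open>n\<close> to \<open>m\<close> has squared norm equal to the sum of
    \<open>q\<close> over \<open>A m - A n\<close>.\<close>
  have rem: "(\<integral>\<^sup>+\<omega>. ennreal ((U \<omega> - S n \<omega>)\<^sup>2) \<partial>M) \<le> ennreal (s - (\<Sum>i\<in>A n. q i))" for n
  proof -
    have "(\<integral>\<^sup>+\<omega>. ennreal ((U \<omega> - S n \<omega>)\<^sup>2) \<partial>M)
        = (\<integral>\<^sup>+\<omega>. liminf (\<lambda>m. ennreal ((S m \<omega> - S n \<omega>)\<^sup>2)) \<partial>M)"
    proof (rule nn_integral_cong_AE, use U(2) in eventually_elim)
      case (elim \<omega>)
      then have "(\<lambda>m. ennreal ((S m \<omega> - S n \<omega>)\<^sup>2)) \<longlonglongrightarrow> ennreal ((U \<omega> - S n \<omega>)\<^sup>2)"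
        unfolding S_def by (intro tendsto_intros tendsto_ennrealI)
      then show ?case by (rule lim_imp_Liminf[symmetric, rotated]) simp
    qed
    also have "\<dots> \<le> liminf (\<lambda>m. \<integral>\<^sup>+\<omega>. ennreal ((S m \<omega> - S n \<omega>)\<^sup>2) \<partial>M)"
      by (rule nn_integral_liminf) simp
    also have "\<dots> = liminf (\<lambda>m. ennreal ((\<Sum>i\<in>A m. q i) - (\<Sum>i\<in>A n. q i)))"
    proof (rule Liminf_eq, rule eventually_sequentiallyI[of n])
      fix m assume "n \<le> m"
      then show "(\<integral>\<^sup>+\<omega>. ennreal ((S m \<omega> - S n \<omega>)\<^sup>2) \<partial>M) = ennreal ((\<Sum>i\<in>A m. q i) - (\<Sum>i\<in>A n. q i))"
        using fin[of "A m - A n"] A by (simp add: sub qsub nn_integral_eq_integral)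
    qed
    also have "\<dots> = ennreal (s - (\<Sum>i\<in>A n. q i))"
      by (intro lim_imp_Liminf tendsto_ennrealI tendsto_intros s') simp
    finally show ?thesis .
  qed
  have intUS: "integrable M (\<lambda>\<omega>. (U \<omega> - S n \<omega>)\<^sup>2)" for n
    using rem[of n] by (intro integrableI_nonneg) (auto simp: less_top[symmetric] top_unique)
  have qle: "(\<Sum>i\<in>A n. q i) \<le> s" for n
    using s' A q0 by (intro incseq_le[OF _ s']) (auto simp: incseq_def intro!: sum_mono2)
  have "ennreal (expectation (\<lambda>\<omega>. (U \<omega> - S n \<omega>)\<^sup>2)) \<le> ennreal (s - (\<Sum>i\<in>A n. q i))" for n
    using rem[of n] intUS[of n] by (simp add: nn_integral_eq_integral)
  then have le: "expectation (\<lambda>\<omega>. (U \<omega> - S n \<omega>)\<^sup>2) \<le> s - (\<Sum>i\<in>A n. q i)" for n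
    using qle by (meson diff_ge_0_iff_ge ennreal_le_iff)
  have lim: "(\<lambda>n. expectation (\<lambda>\<omega>. (U \<omega> - S n \<omega>)\<^sup>2)) \<longlonglongrightarrow> 0"
    by (rule tendsto_sandwich[OF _ _ tendsto_const, of _ _ _ "\<lambda>n. s - (\<Sum>i\<in>A n. q i)"])
       (use tendsto_diff[OF tendsto_const s', of s] le in auto)
  have intS: "integrable M (\<lambda>\<omega>. (S n \<omega>)\<^sup>2)" "expectation (\<lambda>\<omega>. (S n \<omega>)\<^sup>2) = (\<Sum>i\<in>A n. q i)" for n
    using fin[OF A(1)[of n]] unfolding S_def by auto
  have US: "integrable M (\<lambda>\<omega>. (U \<omega> - S n \<omega>) * S n \<omega>)" for n
    by (intro square_integrable_imp_integrable_mult intUS intS) auto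
  \<comment> \<open>Square integrability of \<open>U\<close> is inherited from the remainder
    \<open>U - S 0\<close> and the finite sum \<open>S 0\<close>.\<close>
  have "integrable M (\<lambda>\<omega>. (U \<omega> - S 0 \<omega>)\<^sup>2 + 2 * ((U \<omega> - S 0 \<omega>) * S 0 \<omega>) + (S 0 \<omega>)\<^sup>2)"
    by (intro Bochner_Integration.integrable_add integrable_mult_right US intUS intS)
  then show intU: "integrable M (\<lambda>\<omega>. (U \<omega>)\<^sup>2)"
    by (rule Bochner_Integration.integrable_cong[THEN iffD1, rotated -1, OF _ refl])
       (simp add: power2_eq_square algebra_simps)
  have CS: "(\<lambda>n. expectation (\<lambda>\<omega>. (U \<omega> - S n \<omega>) * V \<omega>)) \<longlonglongrightarrow> 0"
    if [measurable]: "V \<in> borel_measurable M" and V: "integrable M (\<lambda>\<omega>. (V \<omega>)\<^sup>2)" for V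
  proof (rule tendsto_rabs_zero_cancel, rule tendsto_sandwich[OF _ _ tendsto_const])
    have "((\<lambda>n. sqrt (expectation (\<lambda>\<omega>. (U \<omega> - S n \<omega>)\<^sup>2)) * sqrt (expectation (\<lambda>\<omega>. (V \<omega>)\<^sup>2))) \<longlonglongrightarrow>
      sqrt 0 * sqrt (expectation (\<lambda>\<omega>. (V \<omega>)\<^sup>2)))"
      by (intro tendsto_intros lim)
    then show "((\<lambda>n. sqrt (expectation (\<lambda>\<omega>. (U \<omega> - S n \<omega>)\<^sup>2)) * sqrt (expectation (\<lambda>\<omega>. (V \<omega>)\<^sup>2))) \<longlonglongrightarrow> 0)"
      by simp
    have "(expectation (\<lambda>\<omega>. (U \<omega> - S n \<omega>) * V \<omega>))\<^sup>2
        \<le> expectation (\<lambda>\<omega>. (U \<omega> - S n \<omega>)\<^sup>2) * expectation (\<lambda>\<omega>. (V \<omega>)\<^sup>2)" for n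
      by (intro integral_cauchy_schwarz intUS V) auto
    then show "\<forall>\<^sub>F n in sequentially. \<bar>expectation (\<lambda>\<omega>. (U \<omega> - S n \<omega>) * V \<omega>)\<bar>
        \<le> sqrt (expectation (\<lambda>\<omega>. (U \<omega> - S n \<omega>)\<^sup>2)) * sqrt (expectation (\<lambda>\<omega>. (V \<omega>)\<^sup>2))"
      by (intro always_eventually allI) (simp add: real_le_rsqrt real_sqrt_mult[symmetric])
  qed auto
  have USV: "integrable M (\<lambda>\<omega>. (U \<omega> - S n \<omega>) * V \<omega>)"
    if [measurable]: "V \<in> borel_measurable M" and V: "integrable M (\<lambda>\<omega>. (V \<omega>)\<^sup>2)" for V n
    by (intro square_integrable_imp_integrable_mult intUS V) auto
  \<comment> \<open>From \<open>U\<^sup>2 - S\<^sup>2 = 2 * (U - S) * U - (U - S)\<^sup>2\<close>,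
    whose terms vanish in the limit by \<open>CS\<close> and \<open>lim\<close>.\<close>
  have "expectation (\<lambda>\<omega>. (U \<omega>)\<^sup>2) - (\<Sum>i\<in>A n. q i)
      = 2 * expectation (\<lambda>\<omega>. (U \<omega> - S n \<omega>) * U \<omega>) - expectation (\<lambda>\<omega>. (U \<omega> - S n \<omega>)\<^sup>2)" for n
  proof -
    have "expectation (\<lambda>\<omega>. (U \<omega>)\<^sup>2) - (\<Sum>i\<in>A n. q i) = expectation (\<lambda>\<omega>. (U \<omega>)\<^sup>2 - (S n \<omega>)\<^sup>2)"
      by (simp add: intU intS)
    also have "\<dots> = expectation (\<lambda>\<omega>. 2 * ((U \<omega> - S n \<omega>) * U \<omega>) - (U \<omega> - S n \<omega>)\<^sup>2)"
      by (rule Bochner_Integration.integral_cong) (auto simp: power2_eq_square algebra_simps)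
    finally show ?thesis by (simp add: USV[OF U(1) intU] intUS)
  qed
  moreover have "(\<lambda>n. 2 * expectation (\<lambda>\<omega>. (U \<omega> - S n \<omega>) * U \<omega>) - expectation (\<lambda>\<omega>. (U \<omega> - S n \<omega>)\<^sup>2)) \<longlonglongrightarrow> 2 * 0 - 0"
    by (intro tendsto_intros CS U intU lim)
  ultimately have "(\<lambda>n. expectation (\<lambda>\<omega>. (U \<omega>)\<^sup>2) - (\<Sum>i\<in>A n. q i)) \<longlonglongrightarrow> 0" by simp
  moreover have "(\<lambda>n. expectation (\<lambda>\<omega>. (U \<omega>)\<^sup>2) - (\<Sum>i\<in>A n. q i)) \<longlonglongrightarrow> expectation (\<lambda>\<omega>. (U \<omega>)\<^sup>2) - s"
    by (intro tendsto_intros s')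
  ultimately show "expectation (\<lambda>\<omega>. (U \<omega>)\<^sup>2) = s"
    using LIMSEQ_unique by fastforce
  fix V assume [measurable]: "V \<in> borel_measurable M" and V: "integrable M (\<lambda>\<omega>. (V \<omega>)\<^sup>2)"
    and Vorth: "\<And>i. expectation (\<lambda>\<omega>. Z i \<omega> * V \<omega>) = 0"
  have ZV: "integrable M (\<lambda>\<omega>. Z i \<omega> * V \<omega>)" for i
    by (intro square_integrable_imp_integrable_mult Z V) auto
  have SV: "integrable M (\<lambda>\<omega>. S n \<omega> * V \<omega>)" "expectation (\<lambda>\<omega>. S n \<omega> * V \<omega>) = 0" for n
    by (simp_all add: S_def sum_distrib_right ZV Vorth)
  have UV: "integrable M (\<lambda>\<omega>. U \<omega> * V \<omega>)"
    by (intro square_integrable_imp_integrable_mult intU V) auto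
  have "expectation (\<lambda>\<omega>. (U \<omega> - S n \<omega>) * V \<omega>) = expectation (\<lambda>\<omega>. U \<omega> * V \<omega>)" for n
    by (simp add: left_diff_distrib UV SV)
  with CS[OF _ V] show "expectation (\<lambda>\<omega>. U \<omega> * V \<omega>) = 0"
    by (simp add: LIMSEQ_const_iff)
qed

subsection \<open>Picard iterates of the recursion\<close>

text \<open>\<open>range ennreal_of_enat\<close> consists of the natural numbers and infinity.
  Closure under sums, series and suprema puts every iterate in it; hence finite values are natural
  numbers, and counting the indices below a value returns that value.\<close>

lemma SUP_in_range_ennreal_of_enat:
  assumes "\<And>j. f j \<in> range ennreal_of_enat"
  shows "(SUP j. f j) \<in> range ennreal_of_enat"
proof -
  have "\<forall>j. \<exists>m. f j = ennreal_of_enat m"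
    using assms by blast
  then obtain g where g: "\<And>j. f j = ennreal_of_enat (g j)"
    by metis
  have "(SUP j. f j) = ennreal_of_enat (SUP n. g n)"
    unfolding g ennreal_of_enat_Sup image_image ..
  then show ?thesis by (rule range_eqI)
qed

lemma of_nat_in_range_ennreal_of_enat: "of_nat n \<in> range ennreal_of_enat"
  by (metis ennreal_of_enat_enat rangeI)

lemma add_in_range_ennreal_of_enat:
  "x \<in> range ennreal_of_enat \<Longrightarrow> y \<in> range ennreal_of_enat \<Longrightarrow> x + y \<in> range ennreal_of_enat"
  by (auto simp flip: ennreal_of_enat_plus)

lemma suminf_in_range_ennreal_of_enat:
  assumes "\<And>j. f j \<in> range ennreal_of_enat"
  shows "(\<Sum>j. f j) \<in> range ennreal_of_enat"
  unfolding suminf_eq_SUP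
proof (rule SUP_in_range_ennreal_of_enat)
  fix n show "(\<Sum>j<n. f j) \<in> range ennreal_of_enat"
    using of_nat_in_range_ennreal_of_enat[of 0]
    by (induction n) (simp_all add: add_in_range_ennreal_of_enat assms)
qed

lemma finite_in_range_ennreal_of_enat:
  assumes "y \<in> range ennreal_of_enat" "y \<noteq> top"
  obtains n where "y = of_nat n"
  using assms by (auto simp: ennreal_of_enat_def split: enat.splits)

text \<open>Terms of a convergent series of naturals are eventually below 1, hence zero. The sum is
  then finite and has the same value in the discrete topology of \<open>nat\<close> and in
  \<open>ennreal\<close>.\<close>

lemma suminf_of_nat_ennreal:
  fixes f :: "nat \<Rightarrow> nat"
  assumes "(\<Sum>j. of_nat (f j) :: ennreal) \<noteq> top"
  shows "summable f" "(\<Sum>j. of_nat (f j) :: ennreal) = of_nat (\<Sum>j. f j)"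
proof -
  have "summable (\<lambda>j. real (f j))"
    using assms by (intro summable_suminf_not_top) (auto simp: ennreal_of_nat_eq_real_of_nat)
  then have "(\<lambda>j. real (f j)) \<longlonglongrightarrow> 0" by (rule summable_LIMSEQ_zero)
  then have "\<forall>\<^sub>F j in sequentially. real (f j) < 1" by (rule order_tendstoD) simp
  then obtain N where N: "\<And>j. j \<ge> N \<Longrightarrow> f j = 0"
    by (auto simp: eventually_sequentially)
  have f: "f sums (\<Sum>j<N. f j)" by (rule sums_finite) (auto simp: N)
  have "(\<lambda>j. of_nat (f j) :: ennreal) sums (\<Sum>j<N. of_nat (f j))"
    by (rule sums_finite) (auto simp: N)
  then show "summable f" "(\<Sum>j. of_nat (f j) :: ennreal) = of_nat (\<Sum>j. f j)"
    using f by (auto simp: sums_iff)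
qed

text \<open>Truncation by a strict comparison admits an infinite count and is continuous from below
  in \<open>y\<close>: if \<open>l\<close> lies below a supremum, it lies below some member. Since
  entries are numbered from \<open>0\<close>, an integer \<open>y\<close> selects exactly
  \<open>y\<close> of them.\<close>

definition thinned_sum :: "(nat \<Rightarrow> nat) \<Rightarrow> ennreal \<Rightarrow> ennreal" where
  "thinned_sum x y = (\<Sum>l. if of_nat l < y then of_nat (x l) else 0)"

lemma thinned_sum_mono: "y \<le> y' \<Longrightarrow> thinned_sum x y \<le> thinned_sum x y'"
  unfolding thinned_sum_def by (intro suminf_le) auto

lemma thinned_sum_SUP:
  assumes "incseq y"
  shows "thinned_sum x (SUP g. y g) = (SUP g. thinned_sum x (y g))"
proof -
  have "(if of_nat l < (SUP g. y g) then of_nat (x l) else 0)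
      = (SUP g. if of_nat l < y g then of_nat (x l) else (0::ennreal))" for l
  proof (cases "of_nat l < (SUP g. y g)")
    case True
    then obtain g where "of_nat l < y g" by (auto simp: less_SUP_iff)
    then have "(SUP g. if of_nat l < y g then of_nat (x l) else (0::ennreal)) = of_nat (x l)"
      by (intro antisym SUP_least SUP_upper2[of g]) auto
    then show ?thesis using True by simp
  next
    case False
    then have "\<not> of_nat l < y g" for g by (auto simp: less_SUP_iff)
    then show ?thesis using False by simp
  qed
  then have "thinned_sum x (SUP g. y g) = (\<Sum>l. SUP g. if of_nat l < y g then of_nat (x l) else (0::ennreal))"
    unfolding thinned_sum_def by simp
  also have "\<dots> = (SUP g. thinned_sum x (y g))"
    unfolding thinned_sum_def
  proof (intro ennreal_suminf_SUP_eq incseq_SucI)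
    fix l g
    have "y g \<le> y (Suc g)" using assms by (rule incseq_SucD)
    then show "(if of_nat l < y g then of_nat (x l) else 0)
        \<le> (if of_nat l < y (Suc g) then of_nat (x l) else (0::ennreal))"
      by auto
  qed
  finally show ?thesis .
qed

lemma thinned_sum_of_nat: "thinned_sum x (of_nat m) = of_nat (\<Sum>l=1..m. x (l - 1))"
proof -
  have "thinned_sum x (of_nat m) = (\<Sum>l<m. of_nat (x l))"
    unfolding thinned_sum_def
    by (subst suminf_finite[where N="{..<m}"]) auto
  also have "(\<Sum>l<m. of_nat (x l)) = of_nat (\<Sum>l=1..m. x (l - 1))"
    by (simp add: sum.atLeast1_atMost_eq)
  finally show ?thesis .
qed

lemma thinned_sum_in_range: "thinned_sum x y \<in> range ennreal_of_enat"
  unfolding thinned_sum_def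
  using of_nat_in_range_ennreal_of_enat[of 0]
  by (intro suminf_in_range_ennreal_of_enat) (simp add: of_nat_in_range_ennreal_of_enat)

lemma thinned_sum_const:
  assumes "y \<in> range ennreal_of_enat"
  shows "thinned_sum (\<lambda>_. 1) y = y"
proof (cases "y = top")
  case False
  with assms obtain n where "y = of_nat n" by (rule finite_in_range_ennreal_of_enat)
  then show ?thesis by (simp add: thinned_sum_of_nat)
next
  case True
  have "(\<Sum>l. 1 :: ennreal) = top"
    by (simp add: suminf_eq_SUP ennreal_SUP_of_nat_eq_top)
  moreover have "(of_nat l :: ennreal) < top" for l
    by (simp add: of_nat_less_top)
  ultimately show ?thesis using True by (simp add: thinned_sum_def)
qed

text \<open>Innovations are addressed by the index type of \<^const>\<open>INAR_innovations\<close>: \<open>Inl n\<close> for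
  \<open>\<epsilon>\<^sub>n\<close> and \<open>Inr (n, k, l)\<close> for \<open>\<xi>\<^sup>(\<^sup>n\<^sup>,\<^sup>k\<^sup>)\<^sub>l\<close>.\<close>

definition inar_index :: "(int + int \<times> nat \<times> nat) set" where
  "inar_index = UNIV <+> (UNIV \<times> {1..} \<times> {1..})"

definition index_time :: "int + int \<times> nat \<times> nat \<Rightarrow> int" where
  "index_time = case_sum (\<lambda>n. n) fst"

definition shift_index :: "int \<Rightarrow> int + int \<times> nat \<times> nat \<Rightarrow> int + int \<times> nat \<times> nat" where
  "shift_index h = map_sum (\<lambda>n. n + h) (map_prod (\<lambda>n. n + h) id)"

text \<open>Values in \<^typ>\<open>ennreal\<close> make the recursion total and continuous along increasing sequences,
  so its minimal solution is the supremum of the iterates started at \<open>0\<close>, on every path.\<close>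

definition inar_step :: "(int + int \<times> nat \<times> nat \<Rightarrow> nat) \<Rightarrow> (int \<Rightarrow> ennreal) \<Rightarrow> int \<Rightarrow> ennreal" where
  "inar_step e y n = of_nat (e (Inl n)) +
     (\<Sum>j. thinned_sum (\<lambda>l. e (Inr (n, Suc j, Suc l))) (y (n - int (Suc j))))"

primrec inar_iterate :: "(int + int \<times> nat \<times> nat \<Rightarrow> nat) \<Rightarrow> nat \<Rightarrow> int \<Rightarrow> ennreal" where
  "inar_iterate e 0 = (\<lambda>_. 0)"
| "inar_iterate e (Suc g) = inar_step e (inar_iterate e g)"

definition inar_limit :: "(int + int \<times> nat \<times> nat \<Rightarrow> nat) \<Rightarrow> int \<Rightarrow> ennreal" where
  "inar_limit e n = (SUP g. inar_iterate e g n)"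

section \<open>Monotonicity, integrality and the fixed point\<close>

lemma inar_step_mono: "(\<And>n. y n \<le> y' n) \<Longrightarrow> inar_step e y n \<le> inar_step e y' n"
  unfolding inar_step_def by (intro add_left_mono suminf_le thinned_sum_mono) auto

lemma inar_iterate_Suc_le: "inar_iterate e g n \<le> inar_iterate e (Suc g) n"
proof (induction g arbitrary: n)
  case (Suc g)
  then show ?case using inar_step_mono[of "inar_iterate e g" "inar_iterate e (Suc g)"] by simp
qed simp

lemma incseq_inar_iterate: "incseq (\<lambda>g. inar_iterate e g n)"
  by (intro incseq_SucI inar_iterate_Suc_le)

lemma inar_iterate_in_range: "inar_iterate e g n \<in> range ennreal_of_enat"
proof (induction g arbitrary: n)
  case 0
  then show ?case using of_nat_in_range_ennreal_of_enat[of 0] by simp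
next
  case (Suc g)
  show ?case
    by (simp add: inar_step_def add_in_range_ennreal_of_enat of_nat_in_range_ennreal_of_enat
        suminf_in_range_ennreal_of_enat thinned_sum_in_range)
qed

lemma inar_limit_in_range: "inar_limit e n \<in> range ennreal_of_enat"
  unfolding inar_limit_def by (intro SUP_in_range_ennreal_of_enat inar_iterate_in_range)

text \<open>Monotone convergence takes the supremum through the series over lags, and
  \<open>thinned_sum_SUP\<close> takes it through each random sum.\<close>

lemma inar_limit_fixed_point: "inar_limit e n = inar_step e (inar_limit e) n"
proof -
  let ?t = "\<lambda>j g. thinned_sum (\<lambda>l. e (Inr (n, Suc j, Suc l))) (inar_iterate e g (n - int (Suc j)))"
  have inc: "incseq (?t j)" for j
    using incseq_inar_iterate by (auto simp: incseq_def intro!: thinned_sum_mono)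
  have "inar_limit e n = (SUP g. inar_iterate e (Suc g) n)"
  proof (unfold inar_limit_def, rule antisym)
    show "(SUP g. inar_iterate e g n) \<le> (SUP g. inar_iterate e (Suc g) n)"
      by (rule SUP_mono) (use inar_iterate_Suc_le in blast)
    show "(SUP g. inar_iterate e (Suc g) n) \<le> (SUP g. inar_iterate e g n)"
      by (rule SUP_mono) blast
  qed
  also have "\<dots> = of_nat (e (Inl n)) + (SUP g. \<Sum>j. ?t j g)"
    by (simp add: inar_step_def ennreal_SUP_add_right)
  also have "(SUP g. \<Sum>j. ?t j g) = (\<Sum>j. SUP g. ?t j g)"
    by (intro ennreal_suminf_SUP_eq[symmetric] inc)
  also have "\<dots> = (\<Sum>j. thinned_sum (\<lambda>l. e (Inr (n, Suc j, Suc l))) (inar_limit e (n - int (Suc j))))"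
    unfolding inar_limit_def by (simp add: thinned_sum_SUP incseq_inar_iterate)
  finally show ?thesis by (simp add: inar_step_def)
qed

text \<open>A step at \<open>n\<close> reads innovations at time \<open>n\<close> and earlier values
  of \<open>y\<close>, so the iterates are adapted. This is where the independence of the
  constructed solution from later noise originates.\<close>

lemma inar_iterate_cong:
  assumes "\<And>i. i \<in> inar_index \<Longrightarrow> index_time i \<le> n \<Longrightarrow> e i = e' i"
  shows "inar_iterate e g n = inar_iterate e' g n"
  using assms
proof (induction g arbitrary: n)
  case (Suc g)
  have "inar_iterate e g (n - int (Suc j)) = inar_iterate e' g (n - int (Suc j))" for j
    by (rule Suc.IH) (use Suc.prems in auto)
  moreover have "e (Inl n) = e' (Inl n)" "e (Inr (n, Suc j, Suc l)) = e' (Inr (n, Suc j, Suc l))" for j l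
    using Suc.prems[of "Inl n"] Suc.prems[of "Inr (n, Suc j, Suc l)"]
    by (auto simp: inar_index_def index_time_def)
  ultimately show ?case by (simp add: inar_step_def)
qed simp

lemma inar_limit_cong:
  assumes "\<And>i. i \<in> inar_index \<Longrightarrow> index_time i \<le> n \<Longrightarrow> e i = e' i"
  shows "inar_limit e n = inar_limit e' n"
  unfolding inar_limit_def using inar_iterate_cong[OF assms] by simp

text \<open>The recursion has the same form at every time. This equivariance turns a shift invariant
  law of the innovations into stationarity of the limit.\<close>

lemma inar_iterate_shift: "inar_iterate (\<lambda>i. e (shift_index h i)) g n = inar_iterate e g (n + h)"
proof (induction g arbitrary: n)
  case (Suc g)
  have "n - int (Suc j) + h = n + h - int (Suc j)" for j by simp
  then show ?case by (simp only: inar_iterate.simps inar_step_def Suc) (simp add: shift_index_def)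
qed simp

lemma inar_limit_shift: "inar_limit (\<lambda>i. e (shift_index h i)) n = inar_limit e (n + h)"
  unfolding inar_limit_def by (simp add: inar_iterate_shift)

section \<open>Measurability on the path space of the innovations\<close>

lemma measurable_thinned_sum:
  assumes [measurable]: "\<And>l. (\<lambda>\<omega>. x \<omega> l) \<in> measurable M (count_space UNIV)" "y \<in> borel_measurable M"
  shows "(\<lambda>\<omega>. thinned_sum (x \<omega>) (y \<omega>)) \<in> borel_measurable M"
  unfolding thinned_sum_def
  by (intro borel_measurable_suminf_order measurable_If borel_measurable_const borel_measurable_less
      measurable_compose[OF assms(1), where g=of_nat]) (use assms(2) in simp_all)

text \<open>At a coordinate outside \<open>I\<close> all elements of the product space equal
  \<open>undefined\<close>, so evaluation there is constant. One measurability proof thus serves all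
  index sets.\<close>

lemma measurable_PiM_count_space_eval:
  fixes i :: 'a
  shows "(\<lambda>e :: 'a \<Rightarrow> 'b. e i) \<in> measurable (\<Pi>\<^sub>M i\<in>I. count_space UNIV) (count_space UNIV)"
proof (cases "i \<in> I")
  case False
  have "(\<lambda>e :: 'a \<Rightarrow> 'b. e i) \<in> measurable (\<Pi>\<^sub>M i\<in>I. count_space UNIV) (count_space UNIV) \<longleftrightarrow>
      (\<lambda>e :: 'a \<Rightarrow> 'b. undefined) \<in> measurable (\<Pi>\<^sub>M i\<in>I. count_space UNIV) (count_space (UNIV :: 'b set))"
    by (rule measurable_cong) (use False in \<open>auto simp: space_PiM PiE_def extensional_def\<close>)
  then show ?thesis by simp
qed (rule measurable_component_singleton)

lemma measurable_inar_iterate [measurable]: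
  "(\<lambda>e. inar_iterate e g n) \<in> borel_measurable (\<Pi>\<^sub>M i\<in>I. count_space UNIV)"
proof (induction g arbitrary: n)
  case (Suc g)
  have "(\<lambda>e. of_nat (e (Inl n)) :: ennreal) \<in> borel_measurable (\<Pi>\<^sub>M i\<in>I. count_space UNIV)"
    using measurable_compose[OF measurable_PiM_count_space_eval[of "Inl n" I], of of_nat borel] by simp
  moreover have "(\<lambda>e. thinned_sum (\<lambda>l. e (Inr (n, Suc j, Suc l))) (inar_iterate e g (n - int (Suc j))))
      \<in> borel_measurable (\<Pi>\<^sub>M i\<in>I. count_space UNIV)" for j
    by (rule measurable_thinned_sum[where x="\<lambda>e l. e (Inr (n, Suc j, Suc l))"])
       (rule measurable_PiM_count_space_eval, rule Suc)
  ultimately show ?case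
    unfolding inar_iterate.simps inar_step_def
    by (rule borel_measurable_add[OF _ borel_measurable_suminf_order])
qed simp

lemma measurable_inar_limit [measurable]:
  "(\<lambda>e. inar_limit e n) \<in> borel_measurable (\<Pi>\<^sub>M i\<in>I. count_space UNIV)"
  unfolding inar_limit_def by (intro borel_measurable_SUP measurable_inar_iterate) auto

subsection \<open>A stationary solution with finite mean\<close>

text \<open>Unlike \<^const>\<open>prob_space.indep_var\<close>, the two maps may take values in different types.\<close>

definition (in prob_space) indep_maps ::
    "'b measure \<Rightarrow> ('a \<Rightarrow> 'b) \<Rightarrow> 'c measure \<Rightarrow> ('a \<Rightarrow> 'c) \<Rightarrow> bool" where
  "indep_maps S X T Y \<longleftrightarrow> X \<in> measurable M S \<and> Y \<in> measurable M T \<and>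
    indep_set (sets (vimage_algebra (space M) X S)) (sets (vimage_algebra (space M) Y T))"

lemma (in prob_space) indep_var_iff_indep_maps: "indep_var S X T Y \<longleftrightarrow> indep_maps S X T Y"
  unfolding indep_var_eq indep_maps_def sets_vimage_algebra by blast

text \<open>Composition shrinks the generated sigma-algebras, and independence passes to smaller
  ones.\<close>

lemma (in prob_space) indep_maps_compose:
  assumes XY: "indep_maps S X T Y" and F: "F \<in> measurable S S'" and G: "G \<in> measurable T T'"
  shows "indep_maps S' (\<lambda>\<omega>. F (X \<omega>)) T' (\<lambda>\<omega>. G (Y \<omega>))"
proof -
  have X: "X \<in> measurable M S" and Y: "Y \<in> measurable M T"
    and ind: "indep_set (sets (vimage_algebra (space M) X S)) (sets (vimage_algebra (space M) Y T))"
    using XY by (auto simp: indep_maps_def)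
  have sub: "sets (vimage_algebra (space M) (\<lambda>\<omega>. H (Z \<omega>)) R') \<subseteq> sets (vimage_algebra (space M) Z R)"
    if "Z \<in> measurable M R" "H \<in> measurable R R'" for Z H R R'
  proof -
    have Z: "Z \<in> measurable (vimage_algebra (space M) Z R) R"
      by (rule measurable_vimage_algebra1) (use that(1) in \<open>auto dest: measurable_space\<close>)
    have "(\<lambda>\<omega>. H (Z \<omega>)) \<in> measurable (vimage_algebra (space M) Z R) R'"
      by (rule measurable_compose[OF Z that(2)])
    from measurable_sets[OF this] show ?thesis
      unfolding sets_vimage_algebra[of _ "\<lambda>\<omega>. H (Z \<omega>)"]
      by (intro sets.sigma_sets_subset[of _ "vimage_algebra (space M) Z R", simplified]) auto
  qed
  have "indep_set (sets (vimage_algebra (space M) (\<lambda>\<omega>. F (X \<omega>)) S'))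
      (sets (vimage_algebra (space M) (\<lambda>\<omega>. G (Y \<omega>)) T'))"
    using ind unfolding indep_set_def
    by (rule indep_sets_mono_sets) (use sub[OF X F] sub[OF Y G] in \<open>auto split: bool.split\<close>)
  then show ?thesis
    unfolding indep_maps_def using measurable_compose[OF X F] measurable_compose[OF Y G] by auto
qed

lemma (in prob_space) indep_maps_rv2: "indep_maps S X T Y \<Longrightarrow> Y \<in> measurable M T"
  by (simp add: indep_maps_def)

locale inar_innovations = prob_space M for M :: "'a measure" +
  fixes \<alpha> :: "nat \<Rightarrow> real" and K :: real
    and \<epsilon> :: "int \<Rightarrow> 'a \<Rightarrow> nat" and \<xi> :: "int \<Rightarrow> nat \<Rightarrow> nat \<Rightarrow> 'a \<Rightarrow> nat"
  assumes nonneg: "\<And>k. \<alpha> k \<ge> 0"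
    and sums_K: "(\<lambda>j. \<alpha> (Suc j)) sums K"
    and K_less_1: "K < 1"
    and innovations: "INAR_innovations M \<alpha> \<epsilon> \<xi>"
begin

definition \<zeta> :: "int + int \<times> nat \<times> nat \<Rightarrow> 'a \<Rightarrow> nat" where
  "\<zeta> = case_sum \<epsilon> (\<lambda>(n, k, l). \<xi> n k l)"

definition innovation_path :: "'a \<Rightarrow> int + int \<times> nat \<times> nat \<Rightarrow> nat" where
  "innovation_path \<omega> = (\<lambda>i\<in>inar_index. \<zeta> i \<omega>)"

text \<open>This is the pair in the last clause of \<open>INAR_stationary_solution\<close>, which
  thereby becomes a statement about \<open>indep_maps\<close>.\<close>

definition noise :: "int \<Rightarrow> 'a \<Rightarrow> nat \<times> (nat \<times> nat \<Rightarrow> nat)" where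
  "noise n \<omega> = (\<epsilon> n \<omega>, \<lambda>kl\<in>{1..} \<times> {1..}. \<xi> n (fst kl) (snd kl) \<omega>)"

abbreviation noise_space :: "(nat \<times> (nat \<times> nat \<Rightarrow> nat)) measure" where
  "noise_space \<equiv> count_space UNIV \<Otimes>\<^sub>M (\<Pi>\<^sub>M kl\<in>{1..} \<times> {1..}. count_space UNIV)"

lemma K_nonneg: "K \<ge> 0"
  using sums_K nonneg by (metis suminf_nonneg sums_iff)

lemma indep_vars_\<zeta>: "indep_vars (\<lambda>_. count_space UNIV) \<zeta> inar_index"
  using innovations unfolding INAR_innovations_def \<zeta>_def inar_index_def by blast

lemma measurable_\<zeta>: "i \<in> inar_index \<Longrightarrow> \<zeta> i \<in> measurable M (count_space UNIV)"
  using indep_vars_\<zeta> unfolding indep_vars_def by blast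

lemma index_mem [simp]:
  "Inl n \<in> inar_index" "Inr (n, k, l) \<in> inar_index \<longleftrightarrow> k \<ge> 1 \<and> l \<ge> 1"
  "shift_index h i \<in> inar_index \<longleftrightarrow> i \<in> inar_index"
  by (cases i; auto simp: inar_index_def shift_index_def)+

lemma \<zeta>_simps [simp]: "\<zeta> (Inl n) = \<epsilon> n" "\<zeta> (Inr (n, k, l)) = \<xi> n k l"
  by (auto simp: \<zeta>_def)

lemma measurable_\<epsilon> [measurable]: "\<epsilon> n \<in> measurable M (count_space UNIV)"
  using measurable_\<zeta>[of "Inl n"] by simp

lemma measurable_\<xi>: "k \<ge> 1 \<Longrightarrow> l \<ge> 1 \<Longrightarrow> \<xi> n k l \<in> measurable M (count_space UNIV)"
  using measurable_\<zeta>[of "Inr (n, k, l)"] by simp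

lemma measurable_noise [measurable]: "noise n \<in> measurable M noise_space"
  unfolding noise_def
  by (intro measurable_Pair measurable_\<epsilon> measurable_restrict measurable_\<xi>) auto

definition rate :: "int + int \<times> nat \<times> nat \<Rightarrow> real" where
  "rate = case_sum (\<lambda>_. \<alpha> 0) (\<lambda>(n, k, l). \<alpha> k)"

lemma distr_\<zeta>: "i \<in> inar_index \<Longrightarrow> distr M (count_space UNIV) (\<zeta> i) = measure_pmf (pois (rate i))"
  using innovations unfolding INAR_innovations_def rate_def inar_index_def by (auto simp: \<zeta>_def)

lemma rate_nonneg: "rate i \<ge> 0"
  by (auto simp: rate_def nonneg split: sum.split)

lemma has_bochner_integral_\<zeta>:
  assumes "i \<in> inar_index"
  shows "has_bochner_integral M (\<lambda>\<omega>. real (\<zeta> i \<omega>)) (rate i)"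
    and "has_bochner_integral M (\<lambda>\<omega>. (real (\<zeta> i \<omega>) - rate i)\<^sup>2) (rate i)"
proof -
  have "has_bochner_integral (distr M (count_space UNIV) (\<zeta> i)) f x
      \<longleftrightarrow> has_bochner_integral M (\<lambda>\<omega>. f (\<zeta> i \<omega>)) x" for f :: "nat \<Rightarrow> real" and x
    by (simp add: has_bochner_integral_iff integrable_distr_eq integral_distr measurable_\<zeta>[OF assms])
  then have *: "has_bochner_integral (measure_pmf (pois (rate i))) f x
      \<longleftrightarrow> has_bochner_integral M (\<lambda>\<omega>. f (\<zeta> i \<omega>)) x" for f :: "nat \<Rightarrow> real" and x
    unfolding distr_\<zeta>[OF assms] .
  show "has_bochner_integral M (\<lambda>\<omega>. real (\<zeta> i \<omega>)) (rate i)"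
    "has_bochner_integral M (\<lambda>\<omega>. (real (\<zeta> i \<omega>) - rate i)\<^sup>2) (rate i)"
    using pois_moments[OF rate_nonneg[of i]] by (simp_all add: *)
qed

lemma nn_integral_\<zeta>:
  assumes "i \<in> inar_index"
  shows "(\<integral>\<^sup>+\<omega>. of_nat (\<zeta> i \<omega>) \<partial>M) = ennreal (rate i)"
  using has_bochner_integral_\<zeta>(1)[OF assms]
  by (simp add: ennreal_of_nat_eq_real_of_nat has_bochner_integral_iff nn_integral_eq_integral)

section \<open>Shift invariance of the law of the innovations\<close>

definition shifted_path :: "int \<Rightarrow> 'a \<Rightarrow> int + int \<times> nat \<times> nat \<Rightarrow> nat" where
  "shifted_path h \<omega> = (\<lambda>i\<in>inar_index. innovation_path \<omega> (shift_index h i))"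

lemma measurable_innovation_path [measurable]: "innovation_path \<in> measurable M (\<Pi>\<^sub>M i\<in>inar_index. count_space UNIV)"
  unfolding innovation_path_def by (intro measurable_restrict measurable_\<zeta>)

lemma distr_innovation_path:
  "distr M (\<Pi>\<^sub>M i\<in>inar_index. count_space UNIV) innovation_path = (\<Pi>\<^sub>M i\<in>inar_index. measure_pmf (pois (rate i)))"
proof -
  have "inar_index \<noteq> {}" using index_mem(1) by blast
  then have "distr M (\<Pi>\<^sub>M i\<in>inar_index. count_space UNIV) (\<lambda>\<omega>. \<lambda>i\<in>inar_index. \<zeta> i \<omega>)
      = (\<Pi>\<^sub>M i\<in>inar_index. distr M (count_space UNIV) (\<zeta> i))"
    using indep_vars_\<zeta> measurable_\<zeta> by (subst indep_vars_iff_distr_eq_PiM'[symmetric]) auto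
  also have "\<dots> = (\<Pi>\<^sub>M i\<in>inar_index. measure_pmf (pois (rate i)))"
    by (intro PiM_cong distr_\<zeta>) auto
  finally show ?thesis by (simp add: innovation_path_def[abs_def])
qed

lemma measurable_shifted_path [measurable]:
  "shifted_path h \<in> measurable M (\<Pi>\<^sub>M i\<in>inar_index. count_space UNIV)"
  unfolding shifted_path_def
  by (intro measurable_restrict)
     (rule measurable_compose[OF measurable_innovation_path measurable_PiM_count_space_eval])

text \<open>The innovations have a product law with rates that do not depend on time, and a time
  shift reindexes \<open>inar_index\<close> injectively within itself.\<close>

lemma distr_shifted_path:
  "distr M (\<Pi>\<^sub>M i\<in>inar_index. count_space UNIV) (shifted_path h) =
    (\<Pi>\<^sub>M i\<in>inar_index. measure_pmf (pois (rate i)))"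
proof -
  let ?C = "\<Pi>\<^sub>M i\<in>inar_index. count_space (UNIV :: nat set)"
  let ?P = "\<lambda>i. measure_pmf (pois (rate i))"
  have rate: "rate (shift_index h i) = rate i" for i
    by (auto simp: rate_def shift_index_def split: sum.split)
  have inj: "inj_on (shift_index h) inar_index"
    unfolding shift_index_def
    by (intro inj_on_subset[OF sum.inj_map[OF _ prod.inj_map]]) (auto simp: inj_on_def)
  have s: "sets (\<Pi>\<^sub>M i\<in>inar_index. ?P i) = sets ?C" by (intro sets_PiM_cong) auto
  have "distr M ?C (shifted_path h) = distr (distr M ?C innovation_path) ?C (\<lambda>e. \<lambda>i\<in>inar_index. e (shift_index h i))"
    by (subst distr_distr)
       (auto simp: shifted_path_def[abs_def] comp_def intro!: measurable_restrict measurable_PiM_count_space_eval)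
  also have "\<dots> = distr (\<Pi>\<^sub>M i\<in>inar_index. ?P i) (\<Pi>\<^sub>M i\<in>inar_index. ?P (shift_index h i))
      (\<lambda>e. \<lambda>i\<in>inar_index. e (shift_index h i))"
    unfolding distr_innovation_path rate by (intro distr_cong s[symmetric]) auto
  also have "\<dots> = (\<Pi>\<^sub>M i\<in>inar_index. ?P (shift_index h i))"
    by (rule distr_PiM_reindex[OF _ inj]) (auto intro: prob_space_measure_pmf)
  finally show ?thesis by (simp add: rate)
qed

text \<open>The noise at \<open>n\<close> is a function of the coordinates at time \<open>n\<close>,
  a block disjoint from the coordinates at earlier times.\<close>

lemma indep_noise_past_innovations:
  "indep_maps noise_space (noise n) (\<Pi>\<^sub>M i\<in>{i \<in> inar_index. index_time i < n}. count_space UNIV)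
    (\<lambda>\<omega>. \<lambda>i\<in>{i \<in> inar_index. index_time i < n}. \<zeta> i \<omega>)"
proof -
  let ?A = "{i \<in> inar_index. index_time i = n}" and ?B = "{i \<in> inar_index. index_time i < n}"
  let ?f = "\<lambda>e :: int + int \<times> nat \<times> nat \<Rightarrow> nat. (e (Inl n), \<lambda>kl\<in>{1..} \<times> {1..}. e (Inr (n, kl)))"
  have "indep_var (\<Pi>\<^sub>M i\<in>?A. count_space UNIV) (\<lambda>\<omega>. \<lambda>i\<in>?A. \<zeta> i \<omega>)
      (\<Pi>\<^sub>M i\<in>?B. count_space UNIV) (\<lambda>\<omega>. \<lambda>i\<in>?B. \<zeta> i \<omega>)"
    by (rule indep_var_restrict[OF indep_vars_\<zeta>]) auto
  moreover have "?f \<in> measurable (\<Pi>\<^sub>M i\<in>?A. count_space UNIV) noise_space"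
    by (intro measurable_Pair measurable_restrict measurable_PiM_count_space_eval)
  ultimately have "indep_maps noise_space (\<lambda>\<omega>. ?f (\<lambda>i\<in>?A. \<zeta> i \<omega>))
      (\<Pi>\<^sub>M i\<in>?B. count_space UNIV) (\<lambda>\<omega>. \<lambda>i\<in>?B. \<zeta> i \<omega>)"
    unfolding indep_var_iff_indep_maps by (rule indep_maps_compose) simp
  also have "(\<lambda>\<omega>. ?f (\<lambda>i\<in>?A. \<zeta> i \<omega>)) = noise n"
    by (auto simp: fun_eq_iff noise_def index_time_def)
  finally show ?thesis .
qed

text \<open>Wald's identity: the event that the \<open>l\<close>-th summand is counted depends on
  \<open>Y\<close> alone, hence is independent of that summand.\<close>

lemma nn_integral_thinned_sum:
  assumes ind: "indep_maps noise_space (noise n) borel Y" and Y: "\<And>\<omega>. Y \<omega> \<in> range ennreal_of_enat"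
    and k: "k \<ge> 1"
  shows "(\<integral>\<^sup>+\<omega>. thinned_sum (\<lambda>l. \<xi> n k (Suc l) \<omega>) (Y \<omega>) \<partial>M) = ennreal (\<alpha> k) * (\<integral>\<^sup>+\<omega>. Y \<omega> \<partial>M)"
proof -
  have [measurable]: "Y \<in> borel_measurable M" using indep_maps_rv2[OF ind] .
  have [measurable]: "\<xi> n k (Suc l) \<in> measurable M (count_space UNIV)" for l
    by (rule measurable_\<xi>) (use k in auto)
  let ?I = "\<lambda>l y. if of_nat l < y then 1 else 0 :: ennreal"
  have term_eq: "(\<integral>\<^sup>+\<omega>. of_nat (\<xi> n k (Suc l) \<omega>) * ?I l (Y \<omega>) \<partial>M) = ennreal (\<alpha> k) * (\<integral>\<^sup>+\<omega>. ?I l (Y \<omega>) \<partial>M)" for l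
  proof -
    let ?f = "\<lambda>x :: nat \<times> (nat \<times> nat \<Rightarrow> nat). of_nat (snd x (k, Suc l)) :: ennreal"
    have "?f \<in> borel_measurable noise_space"
      using measurable_compose[OF measurable_compose[OF measurable_snd
          measurable_PiM_count_space_eval[of "(k, Suc l)"]], of of_nat borel] by simp
    then have "indep_var borel (\<lambda>\<omega>. ?f (noise n \<omega>)) borel (\<lambda>\<omega>. ?I l (Y \<omega>))"
      unfolding indep_var_iff_indep_maps by (rule indep_maps_compose[OF ind]) simp
    from indep_var_nn_integral[OF this] show ?thesis
      using k nn_integral_\<zeta>[of "Inr (n, k, Suc l)"] by (simp add: noise_def rate_def)
  qed
  have "(\<integral>\<^sup>+\<omega>. thinned_sum (\<lambda>l. \<xi> n k (Suc l) \<omega>) (Y \<omega>) \<partial>M)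
      = (\<integral>\<^sup>+\<omega>. (\<Sum>l. of_nat (\<xi> n k (Suc l) \<omega>) * ?I l (Y \<omega>)) \<partial>M)"
    unfolding thinned_sum_def by (intro nn_integral_cong arg_cong[of _ _ suminf]) auto
  also have "\<dots> = (\<Sum>l. \<integral>\<^sup>+\<omega>. of_nat (\<xi> n k (Suc l) \<omega>) * ?I l (Y \<omega>) \<partial>M)"
    by (rule nn_integral_suminf) simp
  also have "\<dots> = ennreal (\<alpha> k) * (\<integral>\<^sup>+\<omega>. (\<Sum>l. ?I l (Y \<omega>)) \<partial>M)"
    by (simp add: term_eq nn_integral_suminf)
  \<comment> \<open>Counting returns \<open>Y\<close> because its values are extended naturals; a
    fractional value would be rounded up.\<close>
  also have "(\<integral>\<^sup>+\<omega>. (\<Sum>l. ?I l (Y \<omega>)) \<partial>M) = (\<integral>\<^sup>+\<omega>. thinned_sum (\<lambda>_. 1) (Y \<omega>) \<partial>M)"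
    unfolding thinned_sum_def by (simp only: of_nat_1)
  also have "\<dots> = (\<integral>\<^sup>+\<omega>. Y \<omega> \<partial>M)"
    using thinned_sum_const[OF Y] by simp
  finally show ?thesis .
qed

lemma innovation_path_eq:
  "innovation_path \<omega> (Inl n) = \<epsilon> n \<omega>" "innovation_path \<omega> (Inr (n, Suc j, Suc l)) = \<xi> n (Suc j) (Suc l) \<omega>"
  by (simp_all add: innovation_path_def)

text \<open>Wald's identity lag by lag. It serves twice: to bound the means of the iterates, and to
  evaluate the mean of \<open>X\<close>.\<close>

lemma nn_integral_inar_step:
  assumes ind: "\<And>j. indep_maps noise_space (noise n) borel (\<lambda>\<omega>. Y \<omega> (n - int (Suc j)))"
    and Y: "\<And>\<omega> m. Y \<omega> m \<in> range ennreal_of_enat"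
  shows "(\<integral>\<^sup>+\<omega>. inar_step (innovation_path \<omega>) (Y \<omega>) n \<partial>M)
    = ennreal (\<alpha> 0) + (\<Sum>j. ennreal (\<alpha> (Suc j)) * (\<integral>\<^sup>+\<omega>. Y \<omega> (n - int (Suc j)) \<partial>M))"
proof -
  have "(\<lambda>\<omega>. thinned_sum (\<lambda>l. \<xi> n (Suc j) (Suc l) \<omega>) (Y \<omega> (n - int (Suc j)))) \<in> borel_measurable M" for j
    by (rule measurable_thinned_sum[where x="\<lambda>\<omega> l. \<xi> n (Suc j) (Suc l) \<omega>"])
       (rule measurable_\<xi>, simp, simp, rule indep_maps_rv2[OF ind])
  then show ?thesis
    using nn_integral_\<zeta>[of "Inl n"]
    by (simp add: inar_step_def innovation_path_eq nn_integral_add nn_integral_suminf borel_measurable_suminf_order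
        nn_integral_thinned_sum[OF ind Y] rate_def del: of_nat_Suc)
qed

text \<open>Since \<open>F\<close> ignores times from \<open>n\<close> on,
  \<open>innovation_path\<close> may be replaced by its restriction to earlier times, to which
  \<open>indep_noise_past_innovations\<close> applies.\<close>

lemma indep_noise_past_functional:
  assumes F: "F \<in> measurable (\<Pi>\<^sub>M i\<in>{i \<in> inar_index. index_time i < n}. count_space UNIV) N"
    and cong: "\<And>e e'. (\<And>i. i \<in> inar_index \<Longrightarrow> index_time i < n \<Longrightarrow> e i = e' i) \<Longrightarrow> F e = F e'"
  shows "indep_maps noise_space (noise n) N (\<lambda>\<omega>. F (innovation_path \<omega>))"
proof -
  have "indep_maps noise_space (noise n) N
      (\<lambda>\<omega>. F (\<lambda>i\<in>{i \<in> inar_index. index_time i < n}. \<zeta> i \<omega>))"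
    by (rule indep_maps_compose[OF indep_noise_past_innovations _ F]) simp
  also have "(\<lambda>\<omega>. F (\<lambda>i\<in>{i \<in> inar_index. index_time i < n}. \<zeta> i \<omega>)) = (\<lambda>\<omega>. F (innovation_path \<omega>))"
    by (intro ext cong) (simp add: innovation_path_def)
  finally show ?thesis by simp
qed

text \<open>The bound is the fixed point of the increasing map
  \<open>m \<mapsto> \<alpha> 0 + K * m\<close> that governs the means from one iterate to the next;
  starting at \<open>0\<close>, they cannot pass it.\<close>

lemma nn_integral_inar_iterate_le:
  "(\<integral>\<^sup>+\<omega>. inar_iterate (innovation_path \<omega>) g n \<partial>M) \<le> ennreal (\<alpha> 0 / (1 - K))"
proof (induction g arbitrary: n)
  case (Suc g)
  let ?c = "\<alpha> 0 / (1 - K)"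
  have c: "?c \<ge> 0" using nonneg K_less_1 by simp
  have ind: "indep_maps noise_space (noise n) borel (\<lambda>\<omega>. inar_iterate (innovation_path \<omega>) g (n - int (Suc j)))" for j
    by (rule indep_noise_past_functional[where F="\<lambda>e. inar_iterate e g (n - int (Suc j))"])
       (rule measurable_inar_iterate, rule inar_iterate_cong, auto)
  have "(\<integral>\<^sup>+\<omega>. inar_iterate (innovation_path \<omega>) (Suc g) n \<partial>M)
      = ennreal (\<alpha> 0) + (\<Sum>j. ennreal (\<alpha> (Suc j)) * (\<integral>\<^sup>+\<omega>. inar_iterate (innovation_path \<omega>) g (n - int (Suc j)) \<partial>M))"
    unfolding inar_iterate.simps 
    by (rule nn_integral_inar_step[where Y="\<lambda>\<omega>. inar_iterate (innovation_path \<omega>) g", OF ind inar_iterate_in_range])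
  also have "\<dots> \<le> ennreal (\<alpha> 0) + (\<Sum>j. ennreal (\<alpha> (Suc j)) * ennreal ?c)"
    using Suc by (intro add_left_mono suminf_le mult_left_mono) simp_all
  also have "(\<Sum>j. ennreal (\<alpha> (Suc j)) * ennreal ?c) = ennreal K * ennreal ?c"
    unfolding ennreal_suminf_multc suminf_ennreal_eq[OF nonneg sums_K] ..
  also have "ennreal (\<alpha> 0) + ennreal K * ennreal ?c = ennreal (\<alpha> 0 + K * ?c)"
    unfolding ennreal_mult[OF K_nonneg c, symmetric]
    by (intro ennreal_plus[symmetric] nonneg mult_nonneg_nonneg K_nonneg c)
  also have "\<alpha> 0 + K * ?c = ?c"
    using K_less_1 by (simp add: field_simps)
  finally show ?case .
qed simp

lemma nn_integral_inar_limit_le: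
  "(\<integral>\<^sup>+\<omega>. inar_limit (innovation_path \<omega>) n \<partial>M) \<le> ennreal (\<alpha> 0 / (1 - K))"
proof -
  have "(\<integral>\<^sup>+\<omega>. inar_limit (innovation_path \<omega>) n \<partial>M) = (SUP g. \<integral>\<^sup>+\<omega>. inar_iterate (innovation_path \<omega>) g n \<partial>M)"
    unfolding inar_limit_def
  proof (rule nn_integral_monotone_convergence_SUP[where f="\<lambda>g \<omega>. inar_iterate (innovation_path \<omega>) g n"])
    show "incseq (\<lambda>g \<omega>. inar_iterate (innovation_path \<omega>) g n)"
      by (rule incseq_SucI, rule le_funI, rule inar_iterate_Suc_le)
    show "(\<lambda>\<omega>. inar_iterate (innovation_path \<omega>) g n) \<in> borel_measurable M" for g
      by (rule measurable_compose[OF measurable_innovation_path measurable_inar_iterate])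
  qed
  then show ?thesis using nn_integral_inar_iterate_le by (simp add: SUP_least)
qed

text \<open>\<open>enn2real\<close> sends infinity to \<open>0\<close>, so every path becomes
  natural valued; as the limit has finite mean, only a null set is affected.\<close>

definition inar_solution :: "int \<Rightarrow> 'a \<Rightarrow> nat" where
  "inar_solution n \<omega> = nat \<lfloor>enn2real (inar_limit (innovation_path \<omega>) n)\<rfloor>"

lemma AE_inar_limit_eq: "AE \<omega> in M. \<forall>n. inar_limit (innovation_path \<omega>) n = of_nat (inar_solution n \<omega>)"
proof (rule AE_all_countable[THEN iffD2], rule allI)
  fix n
  have "(\<lambda>\<omega>. inar_limit (innovation_path \<omega>) n) \<in> borel_measurable M"
    by (rule measurable_compose[OF measurable_innovation_path measurable_inar_limit])
  moreover have "(\<integral>\<^sup>+\<omega>. inar_limit (innovation_path \<omega>) n \<partial>M) \<noteq> \<infinity>"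
    using nn_integral_inar_limit_le[of n] by (auto simp: top_unique)
  ultimately have "AE \<omega> in M. inar_limit (innovation_path \<omega>) n \<noteq> \<infinity>"
    by (rule nn_integral_PInf_AE)
  then show "AE \<omega> in M. inar_limit (innovation_path \<omega>) n = of_nat (inar_solution n \<omega>)"
  proof eventually_elim
    case (elim \<omega>)
    then obtain m where m: "inar_limit (innovation_path \<omega>) n = of_nat m"
      using finite_in_range_ennreal_of_enat[OF inar_limit_in_range] by (metis infinity_ennreal_def)
    then show ?case by (simp add: inar_solution_def)
  qed
qed

lemma AE_inar_solution_equation:
  "AE \<omega> in M.
     summable (\<lambda>j. \<Sum>l=1..inar_solution (n - int (Suc j)) \<omega>. \<xi> n (Suc j) l \<omega>) \<and>
     inar_solution n \<omega> =
       \<epsilon> n \<omega> + (\<Sum>j. \<Sum>l=1..inar_solution (n - int (Suc j)) \<omega>. \<xi> n (Suc j) l \<omega>)"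
  using AE_inar_limit_eq
proof eventually_elim
  case (elim \<omega>)
  let ?s = "\<lambda>j. \<Sum>l=1..inar_solution (n - int (Suc j)) \<omega>. \<xi> n (Suc j) l \<omega>"
  have eq: "of_nat (inar_solution n \<omega>) = of_nat (\<epsilon> n \<omega>) + (\<Sum>j. of_nat (?s j) :: ennreal)"
    using inar_limit_fixed_point[of "innovation_path \<omega>" n] elim
    by (simp add: inar_step_def innovation_path_eq thinned_sum_of_nat del: of_nat_Suc of_nat_sum)
  \<comment> \<open>The left side of \<open>eq\<close> is a natural number.\<close>
  then have "(\<Sum>j. of_nat (?s j) :: ennreal) \<noteq> top"
    by (metis ennreal_add_eq_top ennreal_of_nat_neq_top)
  note s = suminf_of_nat_ennreal[OF this]
  have "(of_nat (inar_solution n \<omega>) :: ennreal) = of_nat (\<epsilon> n \<omega> + (\<Sum>j. ?s j))"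
    unfolding eq s(2) by simp
  then show ?case using s(1) by (simp only: of_nat_eq_iff)
qed

lemma strictly_stationary_inar_solution: "strictly_stationary M (count_space UNIV) inar_solution"
proof (rule strictly_stationary_factor[where e=shifted_path
      and N="\<Pi>\<^sub>M i\<in>inar_index. count_space UNIV"
      and F="\<lambda>n e. nat \<lfloor>enn2real (inar_limit e n)\<rfloor>"])
  fix n h \<omega>
  \<comment> \<open>\<open>shifted_path\<close> agrees with the shifted innovations on
    \<open>inar_index\<close>, from which \<open>inar_limit\<close> takes all its input.\<close>
  have "inar_limit (innovation_path \<omega>) (n + h) = inar_limit (shifted_path h \<omega>) n"
    unfolding inar_limit_shift[symmetric] by (rule inar_limit_cong) (simp add: shifted_path_def)
  then show "inar_solution (n + h) \<omega> = nat \<lfloor>enn2real (inar_limit (shifted_path h \<omega>) n)\<rfloor>"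
    by (simp add: inar_solution_def)
qed (simp_all add: distr_shifted_path)

lemma INAR_stationary_solution_inar_solution: "INAR_stationary_solution M \<epsilon> \<xi> inar_solution"
proof -
  have "indep_maps noise_space (noise n) (\<Pi>\<^sub>M m\<in>{..<n}. count_space UNIV)
      (\<lambda>\<omega>. (\<lambda>e. \<lambda>m\<in>{..<n}. nat \<lfloor>enn2real (inar_limit e m)\<rfloor>) (innovation_path \<omega>))" for n
  proof (rule indep_noise_past_functional)
    show "(\<lambda>e. \<lambda>m\<in>{..<n}. nat \<lfloor>enn2real (inar_limit e m)\<rfloor>) \<in> measurable
        (\<Pi>\<^sub>M i\<in>{i \<in> inar_index. index_time i < n}. count_space UNIV) (\<Pi>\<^sub>M m\<in>{..<n}. count_space UNIV)"
      by (intro measurable_restrict) simp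
  next
    fix e e' :: "int + int \<times> nat \<times> nat \<Rightarrow> nat"
    assume "\<And>i. i \<in> inar_index \<Longrightarrow> index_time i < n \<Longrightarrow> e i = e' i"
    then have "inar_limit e m = inar_limit e' m" if "m < n" for m
      using that by (intro inar_limit_cong) auto
    then show "(\<lambda>m\<in>{..<n}. nat \<lfloor>enn2real (inar_limit e m)\<rfloor>) = (\<lambda>m\<in>{..<n}. nat \<lfloor>enn2real (inar_limit e' m)\<rfloor>)"
      by (intro restrict_ext) auto
  qed
  then have "indep_set (sets (vimage_algebra (space M) (noise n) noise_space))
      (sets (vimage_algebra (space M) (\<lambda>\<omega>. \<lambda>m\<in>{..<n}. inar_solution m \<omega>)
        (\<Pi>\<^sub>M m\<in>{..<n}. count_space UNIV)))" for n
    unfolding indep_maps_def inar_solution_def by blast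
  then show ?thesis
    unfolding INAR_stationary_solution_def noise_def[abs_def]
    by (intro conjI allI strictly_stationary_inar_solution AE_inar_solution_equation)
qed

end

subsection \<open>The mean of the process\<close>

text \<open>In a discrete space convergent partial sums are eventually constant, so the terms vanish
  from some index on.\<close>

lemma sums_of_nat_nat:
  fixes f :: "nat \<Rightarrow> nat"
  assumes "summable f"
  shows "(\<lambda>j. of_nat (f j) :: 'b :: {semiring_1, topological_space}) sums of_nat (\<Sum>j. f j)"
proof -
  have "(\<lambda>n. \<Sum>j<n. f j) \<longlonglongrightarrow> (\<Sum>j. f j)"
    using assms by (simp add: summable_sums flip: sums_def)
  then obtain N where N: "\<And>n. n \<ge> N \<Longrightarrow> (\<Sum>j<n. f j) = (\<Sum>j. f j)"
    by (auto simp: tendsto_discrete eventually_sequentially)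
  have "f j = 0" if "j \<ge> N" for j
    using N[of j] N[of "Suc j"] that by simp
  then have "(\<lambda>j. of_nat (f j) :: 'b) sums (\<Sum>j<N. of_nat (f j))"
    by (intro sums_finite) auto
  then show ?thesis by (simp add: N flip: of_nat_sum)
qed

lemma strictly_stationary_distr:
  assumes "strictly_stationary M S X"
  shows "distr M S (X n) = distr M S (X 0)"
proof -
  have X: "X n \<in> measurable M S" for n
    using assms by (simp add: strictly_stationary_def)
  \<comment> \<open>\<open>X h\<close> is the coordinate at \<open>0\<close> of the path shifted by
    \<open>h\<close>.\<close>
  have "distr M S (X h) = distr (distr M (\<Pi>\<^sub>M n\<in>UNIV. S) (\<lambda>\<omega> n. X (n + h) \<omega>)) S (\<lambda>x. x 0)" for h
    using measurable_space[OF X]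
    by (subst distr_distr) (auto simp: comp_def intro!: measurable_PiM_single' X)
  then show ?thesis
    using assms unfolding strictly_stationary_def by (metis add_0_right)
qed

text \<open>Applied to the coordinate process, \<open>INAR_residual\<close> is a functional on path
  space. With \<open>I = {..<n}\<close> it presents earlier residuals as functions of the past, with
  \<open>I = UNIV\<close> it yields stationarity of the residuals.\<close>

lemma measurable_INAR_residual_eval:
  "INAR_residual \<alpha> (\<lambda>i x. x i) m \<in> borel_measurable (\<Pi>\<^sub>M i\<in>I. count_space UNIV)"
proof -
  have [measurable]: "(\<lambda>x. real (x i)) \<in> borel_measurable (\<Pi>\<^sub>M i\<in>I. count_space UNIV)" for i :: int
    using measurable_compose[OF measurable_PiM_count_space_eval[of i I], of real borel] by simp
  show ?thesis unfolding INAR_residual_def[abs_def] by measurable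
qed

locale inar_process = inar_innovations M \<alpha> K \<epsilon> \<xi> for M :: "'a measure" and \<alpha> K \<epsilon> \<xi> +
  fixes X :: "int \<Rightarrow> 'a \<Rightarrow> nat"
  assumes process: "INAR_process M \<alpha> \<epsilon> \<xi> X"
begin

definition past :: "int \<Rightarrow> 'a \<Rightarrow> int \<Rightarrow> nat" where
  "past n \<omega> = (\<lambda>m\<in>{..<n}. X m \<omega>)"

abbreviation past_space :: "int \<Rightarrow> (int \<Rightarrow> nat) measure" where
  "past_space n \<equiv> \<Pi>\<^sub>M m\<in>{..<n}. count_space UNIV"

abbreviation u :: "int \<Rightarrow> 'a \<Rightarrow> real" where
  "u \<equiv> INAR_residual \<alpha> X"

definition \<mu> :: real where "\<mu> = \<alpha> 0 / (1 - K)"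

lemma \<mu>_nonneg: "\<mu> \<ge> 0"
  unfolding \<mu>_def using nonneg K_less_1 by simp

lemma \<mu>_eq: "\<alpha> 0 + K * \<mu> = \<mu>"
  unfolding \<mu>_def using K_less_1 by (simp add: field_simps)

lemma solution: "INAR_stationary_solution M \<epsilon> \<xi> X"
  using process by (simp add: INAR_process_def)

lemma stationary: "strictly_stationary M (count_space UNIV) X"
  using solution by (simp add: INAR_stationary_solution_def)

lemma measurable_X [measurable]: "X n \<in> measurable M (count_space UNIV)"
  using stationary by (simp add: strictly_stationary_def)

lemma AE_equation:
  "AE \<omega> in M. summable (\<lambda>j. \<Sum>l=1..X (n - int (Suc j)) \<omega>. \<xi> n (Suc j) l \<omega>) \<and>
     X n \<omega> = \<epsilon> n \<omega> + (\<Sum>j. \<Sum>l=1..X (n - int (Suc j)) \<omega>. \<xi> n (Suc j) l \<omega>)"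
  using solution unfolding INAR_stationary_solution_def by blast

lemma measurable_past [measurable]: "past n \<in> measurable M (past_space n)"
  unfolding past_def by (intro measurable_restrict measurable_X)

lemma indep_noise_past: "indep_maps noise_space (noise n) (past_space n) (past n)"
  unfolding indep_maps_def
  using solution measurable_noise measurable_past
  unfolding INAR_stationary_solution_def noise_def[abs_def] past_def[abs_def] by blast

lemma nn_integral_X_stationary:
  fixes f :: "nat \<Rightarrow> ennreal"
  shows "(\<integral>\<^sup>+\<omega>. f (X n \<omega>) \<partial>M) = (\<integral>\<^sup>+\<omega>. f (X 0 \<omega>) \<partial>M)"
proof -
  have "(\<integral>\<^sup>+\<omega>. f (X n \<omega>) \<partial>M) = (\<integral>\<^sup>+x. f x \<partial>distr M (count_space UNIV) (X n))" for n
    by (rule nn_integral_distr[symmetric]) simp_all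
  then show ?thesis
    using strictly_stationary_distr[OF stationary, of n] by simp
qed

lemma nn_integral_X_finite: "(\<integral>\<^sup>+\<omega>. of_nat (X n \<omega>) \<partial>M) < \<infinity>"
proof -
  have "INAR_stationary_solution M \<epsilon> \<xi> Y \<Longrightarrow> AE \<omega> in M. \<forall>n. Y n \<omega> = X n \<omega>" for Y
    using process by (simp add: INAR_process_def)
  from this[OF INAR_stationary_solution_inar_solution]
  have "AE \<omega> in M. \<forall>n. inar_solution n \<omega> = X n \<omega>" .
  with AE_inar_limit_eq have "AE \<omega> in M. of_nat (X n \<omega>) = inar_limit (innovation_path \<omega>) n"
    by eventually_elim simp
  then have "(\<integral>\<^sup>+\<omega>. of_nat (X n \<omega>) \<partial>M) = (\<integral>\<^sup>+\<omega>. inar_limit (innovation_path \<omega>) n \<partial>M)"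
    by (rule nn_integral_cong_AE)
  also have "\<dots> < \<infinity>"
    using nn_integral_inar_limit_le by (rule le_less_trans) simp
  finally show ?thesis .
qed

lemma indep_noise_X:
  assumes "m < n"
  shows "indep_maps noise_space (noise n) borel (\<lambda>\<omega>. of_nat (X m \<omega>) :: ennreal)"
proof -
  have "(\<lambda>x. of_nat (x m) :: ennreal) \<in> borel_measurable (past_space n)"
    using measurable_compose[OF measurable_PiM_count_space_eval[of m "{..<n}"], of of_nat borel] by simp
  from indep_maps_compose[OF indep_noise_past measurable_ident this] show ?thesis
    using assms by (simp add: past_def)
qed

lemma nn_integral_X: "(\<integral>\<^sup>+\<omega>. of_nat (X n \<omega>) \<partial>M) = ennreal \<mu>"
proof -
  obtain m where m: "(\<integral>\<^sup>+\<omega>. of_nat (X 0 \<omega>) \<partial>M) = ennreal m" "m \<ge> 0"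
    using nn_integral_X_finite[of 0] by (metis less_top_ennreal infinity_ennreal_def)
  \<comment> \<open>By stationarity one number serves for all lags and factors out of the
    series.\<close>
  have mean: "(\<integral>\<^sup>+\<omega>. of_nat (X n \<omega>) \<partial>M) = ennreal m" for n
    unfolding m(1)[symmetric] by (rule nn_integral_X_stationary)
  have "AE \<omega> in M. of_nat (X 0 \<omega>) = inar_step (innovation_path \<omega>) (\<lambda>m. of_nat (X m \<omega>)) 0"
    using AE_equation[of 0]
  proof eventually_elim
    case (elim \<omega>)
    let ?s = "\<lambda>j. \<Sum>l=1..X (0 - int (Suc j)) \<omega>. \<xi> 0 (Suc j) l \<omega>"
    have "(\<Sum>j. of_nat (?s j) :: ennreal) = of_nat (\<Sum>j. ?s j)"
      using elim by (intro sums_unique[symmetric] sums_of_nat_nat) blast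
    then show ?case
      using elim by (simp add: inar_step_def innovation_path_eq thinned_sum_of_nat del: of_nat_Suc of_nat_sum)
  qed
  then have "ennreal m = (\<integral>\<^sup>+\<omega>. inar_step (innovation_path \<omega>) (\<lambda>m. of_nat (X m \<omega>)) 0 \<partial>M)"
    unfolding m(1)[symmetric] by (rule nn_integral_cong_AE)
  also have "\<dots> = ennreal (\<alpha> 0) + (\<Sum>j. ennreal (\<alpha> (Suc j)) * ennreal m)"
  proof -
    have "indep_maps noise_space (noise 0) borel (\<lambda>\<omega>. of_nat (X (0 - int (Suc j)) \<omega>) :: ennreal)" for j
      by (rule indep_noise_X) simp
    from nn_integral_inar_step[where Y="\<lambda>\<omega> m. of_nat (X m \<omega>)", OF this of_nat_in_range_ennreal_of_enat]
    show ?thesis unfolding mean .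
  qed
  also have "\<dots> = ennreal (\<alpha> 0) + ennreal K * ennreal m"
    unfolding ennreal_suminf_multc suminf_ennreal_eq[OF nonneg sums_K] ..
  also have "\<dots> = ennreal (\<alpha> 0 + K * m)"
    unfolding ennreal_mult[OF K_nonneg m(2), symmetric]
    by (intro ennreal_plus[symmetric] nonneg mult_nonneg_nonneg K_nonneg m)
  finally have "m = \<alpha> 0 + K * m"
    using m nonneg K_nonneg by (subst (asm) ennreal_inj) auto
  then have "m = \<mu>"
    unfolding \<mu>_def using K_less_1 by (simp add: field_simps)
  then show ?thesis using mean by simp
qed

lemma has_bochner_integral_X: "has_bochner_integral M (\<lambda>\<omega>. real (X n \<omega>)) \<mu>"
  using nn_integral_X[of n] \<mu>_nonneg
  by (intro has_bochner_integral_nn_integral) (auto simp: ennreal_of_nat_eq_real_of_nat)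

text \<open>The series of nonnegative terms has the finite mean \<open>K * \<mu>\<close>.\<close>

lemma AE_summable_X: "AE \<omega> in M. summable (\<lambda>j. \<alpha> (Suc j) * real (X (n - int (Suc j)) \<omega>))"
proof -
  let ?f = "\<lambda>j \<omega>. ennreal (\<alpha> (Suc j) * real (X (n - int (Suc j)) \<omega>))"
  have "(\<integral>\<^sup>+\<omega>. ?f j \<omega> \<partial>M) = ennreal (\<alpha> (Suc j)) * ennreal \<mu>" for j
    using nn_integral_X[of "n - int (Suc j)"]
    by (simp add: ennreal_mult nonneg nn_integral_cmult ennreal_of_nat_eq_real_of_nat del: of_nat_Suc)
  then have "(\<integral>\<^sup>+\<omega>. (\<Sum>j. ?f j \<omega>) \<partial>M) = (\<Sum>j. ennreal (\<alpha> (Suc j)) * ennreal \<mu>)"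
    by (subst nn_integral_suminf) simp_all
  also have "\<dots> = ennreal K * ennreal \<mu>"
    unfolding ennreal_suminf_multc suminf_ennreal_eq[OF nonneg sums_K] ..
  finally have "(\<integral>\<^sup>+\<omega>. (\<Sum>j. ?f j \<omega>) \<partial>M) \<noteq> \<infinity>"
    by (simp add: ennreal_mult_eq_top_iff)
  then have "AE \<omega> in M. (\<Sum>j. ?f j \<omega>) \<noteq> \<infinity>"
    by (intro nn_integral_PInf_AE borel_measurable_suminf_order) auto
  then show ?thesis
    by eventually_elim (rule summable_suminf_not_top, auto simp: nonneg)
qed

end

subsection \<open>The residual as an orthogonal series\<close>

context inar_process
begin

text \<open>Index \<open>None\<close> stands for the term \<open>\<epsilon>\<^sub>n - \<alpha>\<^sub>0\<close> of the expansion of \<open>u\<^sub>n\<close>, and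
  \<open>Some (j, l)\<close> for the term \<open>(\<xi>\<^sup>(\<^sup>n\<^sup>,\<^sup>k\<^sup>)\<^sub>m - \<alpha>\<^sub>k) 1[m \<le> X\<^sub>n\<^sub>-\<^sub>k]\<close> with \<open>k = j + 1\<close>, \<open>m = l + 1\<close>.\<close>

definition term_index :: "int \<Rightarrow> (nat \<times> nat) option \<Rightarrow> int + int \<times> nat \<times> nat" where
  "term_index n i = (case i of None \<Rightarrow> Inl n | Some (j, l) \<Rightarrow> Inr (n, Suc j, Suc l))"

definition centred :: "int \<Rightarrow> (nat \<times> nat) option \<Rightarrow> nat \<times> (nat \<times> nat \<Rightarrow> nat) \<Rightarrow> real" where
  "centred n i p = (case i of None \<Rightarrow> real (fst p) | Some (j, l) \<Rightarrow> real (snd p (Suc j, Suc l)))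
     - rate (term_index n i)"

definition alive :: "int \<Rightarrow> (nat \<times> nat) option \<Rightarrow> (int \<Rightarrow> nat) \<Rightarrow> real" where
  "alive n i x = (case i of None \<Rightarrow> 1 | Some (j, l) \<Rightarrow> of_bool (l < x (n - int (Suc j))))"

text \<open>Splitting into a function of the noise at \<open>n\<close> and a function of the past
  before \<open>n\<close> lets independence factor every expectation; the first factor has mean
  zero.\<close>

definition residual_term :: "int \<Rightarrow> (nat \<times> nat) option \<Rightarrow> 'a \<Rightarrow> real" where
  "residual_term n i \<omega> = centred n i (noise n \<omega>) * alive n i (past n \<omega>)"

lemma term_index_mem: "term_index n i \<in> inar_index"
  by (auto simp: term_index_def split: option.split)

lemma centred_noise: "centred n i (noise n \<omega>) = real (\<zeta> (term_index n i) \<omega>) - rate (term_index n i)"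
  by (auto simp: centred_def noise_def term_index_def split: option.split)

lemma inj_term_index: "term_index n i = term_index n j \<longleftrightarrow> i = j"
  by (auto simp: term_index_def split: option.splits)

lemma measurable_centred [measurable]: "centred n i \<in> borel_measurable noise_space"
proof (cases i)
  case None
  then show ?thesis unfolding centred_def[abs_def] by simp
next
  case (Some jl)
  have "(\<lambda>p. real (snd p (Suc (fst jl), Suc (snd jl)))) \<in> borel_measurable noise_space"
    using measurable_compose[OF measurable_compose[OF measurable_snd
        measurable_PiM_count_space_eval[of "(Suc (fst jl), Suc (snd jl))"]], of real borel] by simp
  with Some show ?thesis unfolding centred_def[abs_def] by (simp add: case_prod_beta)
qed

lemma measurable_alive [measurable]: "alive n i \<in> borel_measurable (past_space n)"
proof (cases i)
  case None
  then show ?thesis unfolding alive_def[abs_def] by simp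
next
  case (Some jl)
  have "(\<lambda>x. of_bool (snd jl < x (n - int (Suc (fst jl)))) :: real) \<in> borel_measurable (past_space n)"
    using measurable_compose[OF measurable_PiM_count_space_eval[of "n - int (Suc (fst jl))" "{..<n}"],
        of "\<lambda>y. of_bool (snd jl < y) :: real" borel] by simp
  with Some show ?thesis unfolding alive_def[abs_def] by (simp add: case_prod_beta)
qed

lemma alive_bound: "\<bar>alive n i x\<bar> \<le> 1"
  by (auto simp: alive_def split: option.split)

lemma measurable_centred_noise [measurable]: "(\<lambda>\<omega>. centred n i (noise n \<omega>)) \<in> borel_measurable M"
  by (rule measurable_compose[OF measurable_noise measurable_centred])

lemma measurable_alive_past [measurable]: "(\<lambda>\<omega>. alive n i (past n \<omega>)) \<in> borel_measurable M"
  by (rule measurable_compose[OF measurable_past measurable_alive])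

lemma measurable_residual_term: "residual_term n i \<in> borel_measurable M"
  unfolding residual_term_def[abs_def] by measurable

lemma has_bochner_integral_centred:
  "has_bochner_integral M (\<lambda>\<omega>. centred n i (noise n \<omega>)) 0"
  "has_bochner_integral M (\<lambda>\<omega>. (centred n i (noise n \<omega>))\<^sup>2) (rate (term_index n i))"
proof -
  note * = has_bochner_integral_\<zeta>[OF term_index_mem, of n i]
  show "has_bochner_integral M (\<lambda>\<omega>. (centred n i (noise n \<omega>))\<^sup>2) (rate (term_index n i))"
    using *(2) by (simp add: centred_noise)
  show "has_bochner_integral M (\<lambda>\<omega>. centred n i (noise n \<omega>)) 0"
    using *(1) by (simp add: centred_noise has_bochner_integral_iff prob_space)
qed

lemma expectation_centred_mult:
  assumes "i \<noteq> j"
  shows "integrable M (\<lambda>\<omega>. centred n i (noise n \<omega>) * centred n j (noise n \<omega>))"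
    and "expectation (\<lambda>\<omega>. centred n i (noise n \<omega>) * centred n j (noise n \<omega>)) = 0"
proof -
  have "indep_maps (count_space UNIV) (\<zeta> (term_index n i)) (count_space UNIV) (\<zeta> (term_index n j))"
    unfolding indep_var_iff_indep_maps[symmetric]
    by (rule indep_vars_imp_indep_var[OF indep_vars_\<zeta> term_index_mem term_index_mem])
       (simp add: inj_term_index assms)
  then have "indep_maps borel (\<lambda>\<omega>. real (\<zeta> (term_index n i) \<omega>) - rate (term_index n i))
      borel (\<lambda>\<omega>. real (\<zeta> (term_index n j) \<omega>) - rate (term_index n j))"
    by (rule indep_maps_compose) simp_all
  then have ind: "indep_var borel (\<lambda>\<omega>. centred n i (noise n \<omega>)) borel (\<lambda>\<omega>. centred n j (noise n \<omega>))"
    unfolding indep_var_iff_indep_maps centred_noise .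
  note c = has_bochner_integral_centred(1)[of n, unfolded has_bochner_integral_iff]
  show "integrable M (\<lambda>\<omega>. centred n i (noise n \<omega>) * centred n j (noise n \<omega>))"
    by (rule indep_var_integrable[OF ind]) (use c in auto)
  show "expectation (\<lambda>\<omega>. centred n i (noise n \<omega>) * centred n j (noise n \<omega>)) = 0"
    by (subst indep_var_lebesgue_integral[OF ind]) (use c in auto)
qed

lemma expectation_noise_past:
  fixes f :: "nat \<times> (nat \<times> nat \<Rightarrow> nat) \<Rightarrow> real" and g :: "(int \<Rightarrow> nat) \<Rightarrow> real"
  assumes "f \<in> borel_measurable noise_space" "g \<in> borel_measurable (past_space n)"
    and "integrable M (\<lambda>\<omega>. f (noise n \<omega>))" "integrable M (\<lambda>\<omega>. g (past n \<omega>))"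
  shows "integrable M (\<lambda>\<omega>. f (noise n \<omega>) * g (past n \<omega>))"
    and "expectation (\<lambda>\<omega>. f (noise n \<omega>) * g (past n \<omega>)) =
      expectation (\<lambda>\<omega>. f (noise n \<omega>)) * expectation (\<lambda>\<omega>. g (past n \<omega>))"
proof -
  have ind: "indep_var borel (\<lambda>\<omega>. f (noise n \<omega>)) borel (\<lambda>\<omega>. g (past n \<omega>))"
    unfolding indep_var_iff_indep_maps by (rule indep_maps_compose[OF indep_noise_past assms(1,2)])
  show "integrable M (\<lambda>\<omega>. f (noise n \<omega>) * g (past n \<omega>))"
    by (rule indep_var_integrable[OF ind assms(3,4)])
  show "expectation (\<lambda>\<omega>. f (noise n \<omega>) * g (past n \<omega>)) =
      expectation (\<lambda>\<omega>. f (noise n \<omega>)) * expectation (\<lambda>\<omega>. g (past n \<omega>))"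
    by (rule indep_var_lebesgue_integral[OF ind assms(3,4)])
qed

lemma integrable_alive_mult: "integrable M (\<lambda>\<omega>. alive n i (past n \<omega>) * alive n j (past n \<omega>))"
  by (rule integrable_const_bound[where B=1])
     (auto simp: abs_mult intro!: mult_le_one alive_bound)

text \<open>The two indicators may be dependent, but both belong to the past factor. The noise
  factor is a product of two distinct centred innovations and has mean zero.\<close>

lemma expectation_residual_term_mult:
  assumes "i \<noteq> j"
  shows "expectation (\<lambda>\<omega>. residual_term n i \<omega> * residual_term n j \<omega>) = 0"
proof -
  have "residual_term n i \<omega> * residual_term n j \<omega>
      = (\<lambda>p. centred n i p * centred n j p) (noise n \<omega>) * (\<lambda>x. alive n i x * alive n j x) (past n \<omega>)" for \<omega>
    by (simp add: residual_term_def)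
  moreover have "(\<lambda>p. centred n i p * centred n j p) \<in> borel_measurable noise_space"
    "(\<lambda>x. alive n i x * alive n j x) \<in> borel_measurable (past_space n)"
    by (intro borel_measurable_times measurable_centred measurable_alive)+
  note expectation_noise_past(2)[OF this expectation_centred_mult(1)[OF assms] integrable_alive_mult]
  ultimately show ?thesis
    by (simp add: expectation_centred_mult(2)[OF assms])
qed

section \<open>Squared norms of the terms\<close>

lemma prob_X_stationary: "prob {\<omega> \<in> space M. l < X n \<omega>} = prob {\<omega> \<in> space M. l < X 0 \<omega>}"
proof -
  have "prob {\<omega> \<in> space M. l < X n \<omega>} = measure (distr M (count_space UNIV) (X n)) {y. l < y}" for n
    by (subst measure_distr) (auto intro!: arg_cong[where f=prob])
  then show ?thesis
    using strictly_stationary_distr[OF stationary, of n] by simp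
qed

definition tail :: "nat \<Rightarrow> real" where
  "tail l = prob {\<omega> \<in> space M. l < X 0 \<omega>}"

text \<open>Tail formula for the mean: \<open>X 0\<close> is the number of \<open>l\<close> with
  \<open>l < X 0\<close>, and expectations are taken term by term.\<close>

lemma sums_tail: "tail sums \<mu>"
proof -
  have "ennreal \<mu> = (\<integral>\<^sup>+\<omega>. thinned_sum (\<lambda>_. 1) (of_nat (X 0 \<omega>)) \<partial>M)"
    using nn_integral_X[of 0] thinned_sum_const[OF of_nat_in_range_ennreal_of_enat] by simp
  also have "\<dots> = (\<integral>\<^sup>+\<omega>. (\<Sum>l. indicator {\<omega> \<in> space M. l < X 0 \<omega>} \<omega>) \<partial>M)"
    unfolding thinned_sum_def
    by (intro nn_integral_cong arg_cong[of _ _ suminf] ext) (simp split: split_indicator)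
  also have "\<dots> = (\<Sum>l. ennreal (tail l))"
    unfolding tail_def by (subst nn_integral_suminf) (simp_all add: emeasure_eq_measure)
  finally have eq: "(\<Sum>l. ennreal (tail l)) = ennreal \<mu>" ..
  have nonneg_tail: "tail l \<ge> 0" for l by (simp add: tail_def)
  have s: "summable tail"
    by (rule summable_suminf_not_top[OF nonneg_tail]) (simp add: eq)
  have "ennreal (\<Sum>l. tail l) = ennreal \<mu>"
    using suminf_ennreal2[OF nonneg_tail s] eq by simp
  then have "(\<Sum>l. tail l) = \<mu>"
    using suminf_nonneg[OF s nonneg_tail] \<mu>_nonneg by (simp add: ennreal_inj)
  with s show ?thesis by (simp add: sums_iff)
qed

text \<open>The noise factor contributes a Poisson variance, equal to its rate; the squared
  indicator contributes a tail probability, which by stationarity is that of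
  \<open>X 0\<close>.\<close>

lemma residual_term_square:
  "integrable M (\<lambda>\<omega>. (residual_term n i \<omega>)\<^sup>2)"
  "expectation (\<lambda>\<omega>. (residual_term n i \<omega>)\<^sup>2) = (case i of None \<Rightarrow> \<alpha> 0 | Some (j, l) \<Rightarrow> \<alpha> (Suc j) * tail l)"
proof -
  have eq: "(residual_term n i \<omega>)\<^sup>2
      = (\<lambda>p. (centred n i p)\<^sup>2) (noise n \<omega>) * (\<lambda>x. alive n i x * alive n i x) (past n \<omega>)" for \<omega>
    by (simp add: residual_term_def power2_eq_square)
  note c = has_bochner_integral_centred(2)[of n i, unfolded has_bochner_integral_iff]
  have m: "(\<lambda>p. (centred n i p)\<^sup>2) \<in> borel_measurable noise_space"
    "(\<lambda>x. alive n i x * alive n i x) \<in> borel_measurable (past_space n)"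
    by (intro borel_measurable_power borel_measurable_times measurable_centred measurable_alive)+
  note e = expectation_noise_past[OF m conjunct1[OF c] integrable_alive_mult]
  show "integrable M (\<lambda>\<omega>. (residual_term n i \<omega>)\<^sup>2)"
    unfolding eq by (rule e(1))
  have "expectation (\<lambda>\<omega>. (residual_term n i \<omega>)\<^sup>2)
      = rate (term_index n i) * expectation (\<lambda>\<omega>. alive n i (past n \<omega>) * alive n i (past n \<omega>))"
    unfolding eq e(2) using c by simp
  also have "\<dots> = (case i of None \<Rightarrow> \<alpha> 0 | Some (j, l) \<Rightarrow> \<alpha> (Suc j) * tail l)"
  proof (cases i)
    case None
    then show ?thesis by (simp add: rate_def term_index_def alive_def prob_space)
  next
    case (Some jl)
    obtain j l where jl: "jl = (j, l)" by force
    let ?m = "n - int (Suc j)"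
    have "expectation (\<lambda>\<omega>. alive n i (past n \<omega>) * alive n i (past n \<omega>))
        = expectation (indicator {\<omega> \<in> space M. l < X ?m \<omega>})"
      by (intro Bochner_Integration.integral_cong refl) (simp add: alive_def Some jl past_def split: split_indicator)
    also have "\<dots> = prob {\<omega> \<in> space M. l < X ?m \<omega>}" by simp
    also have "\<dots> = tail l" unfolding tail_def by (rule prob_X_stationary)
    finally show ?thesis by (simp add: Some jl rate_def term_index_def)
  qed
  finally show "expectation (\<lambda>\<omega>. (residual_term n i \<omega>)\<^sup>2)
      = (case i of None \<Rightarrow> \<alpha> 0 | Some (j, l) \<Rightarrow> \<alpha> (Suc j) * tail l)" .
qed

text \<open>On squares the sum of the squared norms factors into partial sums of
  \<open>\<alpha>\<close> and of \<open>tail\<close>, with limit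
  \<open>\<alpha> 0 + K * \<mu>\<close>.\<close>

definition index_box :: "nat \<Rightarrow> (nat \<times> nat) option set" where
  "index_box N = insert None (Some ` ({..<N} \<times> {..<N}))"

lemma finite_index_box: "finite (index_box N)" and incseq_index_box: "incseq index_box"
  by (auto simp: index_box_def incseq_def)

lemma sum_index_box: "(\<Sum>i\<in>index_box N. f i) = f None + (\<Sum>j<N. \<Sum>l<N. f (Some (j, l)))"
  for f :: "(nat \<times> nat) option \<Rightarrow> real"
proof -
  have "(\<Sum>i\<in>index_box N. f i) = f None + (\<Sum>i\<in>Some ` ({..<N} \<times> {..<N}). f i)"
    unfolding index_box_def by (subst sum.insert) auto
  also have "(\<Sum>i\<in>Some ` ({..<N} \<times> {..<N}). f i) = (\<Sum>p\<in>{..<N} \<times> {..<N}. f (Some p))"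
    by (subst sum.reindex) auto
  finally show ?thesis by (simp add: sum.cartesian_product case_prod_beta)
qed

lemma box_square_limit:
  "(\<lambda>N. \<Sum>i\<in>index_box N. expectation (\<lambda>\<omega>. (residual_term n i \<omega>)\<^sup>2)) \<longlonglongrightarrow> \<mu>"
proof -
  have "(\<lambda>N. \<alpha> 0 + (\<Sum>j<N. \<alpha> (Suc j)) * (\<Sum>l<N. tail l)) \<longlonglongrightarrow> \<alpha> 0 + K * \<mu>"
    using sums_K sums_tail unfolding sums_def by (intro tendsto_intros)
  then show ?thesis
    by (simp add: sum_index_box residual_term_square sum_product \<mu>_eq)
qed

text \<open>Each lag contributes a truncated random sum minus its compensator. Infinitely many
  compensators may be nonzero, so the limit is exchanged with the series by domination (Tannery's
  theorem), using the convergence of both series without truncation.\<close>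

lemma AE_box_limit: "AE \<omega> in M. (\<lambda>N. \<Sum>i\<in>index_box N. residual_term n i \<omega>) \<longlonglongrightarrow> u n \<omega>"
  using AE_equation[of n] AE_summable_X[of n]
proof eventually_elim
  case (elim \<omega>)
  define x where "x j = X (n - int (Suc j)) \<omega>" for j
  define s where "s j = (\<Sum>l=1..x j. \<xi> n (Suc j) l \<omega>)" for j
  define b where "b j = real (s j) - \<alpha> (Suc j) * real (x j)" for j
  \<comment> \<open>Rows outside the box are padded by zero, so that a box sum is a full series in
    \<open>j\<close>.\<close>
  define a where "a j N = (if j < N then \<Sum>l<N. residual_term n (Some (j, l)) \<omega> else 0)" for j N
  have s: "(\<lambda>j. real (s j)) sums real (\<Sum>j. s j)" and X: "X n \<omega> = \<epsilon> n \<omega> + (\<Sum>j. s j)"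
    using elim(1) sums_of_nat_nat[of s, where ?'b=real] unfolding s_def x_def by blast+
  have ax: "summable (\<lambda>j. \<alpha> (Suc j) * real (x j))"
    using elim(2) by (simp add: x_def)
  have r: "residual_term n (Some (j, l)) \<omega>
      = (if l < x j then real (\<xi> n (Suc j) (Suc l) \<omega>) - \<alpha> (Suc j) else 0)" for j l
    by (simp add: residual_term_def centred_noise alive_def term_index_def rate_def past_def x_def)
  have a: "a j N = (if j < N then (\<Sum>l<min N (x j). real (\<xi> n (Suc j) (Suc l) \<omega>)) -
      \<alpha> (Suc j) * real (min N (x j)) else 0)" for j N
  proof -
    have "(\<Sum>l<N. residual_term n (Some (j, l)) \<omega>)
        = (\<Sum>l\<in>{..<N} \<inter> {l. l < x j}. real (\<xi> n (Suc j) (Suc l) \<omega>) - \<alpha> (Suc j))"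
      unfolding r by (subst sum.inter_restrict) auto
    also have "{..<N} \<inter> {l. l < x j} = {..<min N (x j)}" by auto
    finally show ?thesis by (simp add: a_def sum_subtractf)
  qed
  have s_eq: "real (s j) = (\<Sum>l<x j. real (\<xi> n (Suc j) (Suc l) \<omega>))" for j
    unfolding s_def by (simp add: sum.atLeast1_atMost_eq)
  \<comment> \<open>From \<open>Suc j + x j\<close> on, the box contains row \<open>j\<close> and
    all of its nonzero entries.\<close>
  have lim: "(\<lambda>N. a j N) \<longlonglongrightarrow> b j" for j
  proof (rule tendsto_eventually, rule eventually_sequentiallyI[of "Suc j + x j"])
    fix N assume "Suc j + x j \<le> N"
    then show "a j N = b j" by (simp add: a b_def s_eq min_absorb2)
  qed
  have bound: "norm (a j N) \<le> real (s j) + \<alpha> (Suc j) * real (x j)" for j N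
  proof -
    have "(\<Sum>l<min N (x j). real (\<xi> n (Suc j) (Suc l) \<omega>)) \<le> real (s j)"
      unfolding s_eq by (rule sum_mono2) auto
    moreover have "0 \<le> (\<Sum>l<min N (x j). real (\<xi> n (Suc j) (Suc l) \<omega>))"
      by (rule sum_nonneg) simp
    moreover have "\<alpha> (Suc j) * real (min N (x j)) \<le> \<alpha> (Suc j) * real (x j)"
      by (rule mult_left_mono) (auto simp: nonneg)
    moreover have "0 \<le> \<alpha> (Suc j) * real (min N (x j))"
      by (simp add: nonneg)
    ultimately show ?thesis unfolding a real_norm_def by (auto simp: abs_if)
  qed
  have "(\<lambda>N. \<Sum>j. a j N) \<longlonglongrightarrow> (\<Sum>j. b j)"
  proof (intro tannerys_theorem[THEN conjunct2, THEN conjunct2] lim)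
    show "\<forall>\<^sub>F (j, N) in sequentially \<times>\<^sub>F sequentially. norm (a j N) \<le> real (s j) + \<alpha> (Suc j) * real (x j)"
      using bound by (intro always_eventually) auto
    show "summable (\<lambda>j. real (s j) + \<alpha> (Suc j) * real (x j))"
      by (rule summable_add[OF sums_summable[OF s] ax])
  qed simp
  moreover have "(\<Sum>j. a j N) = (\<Sum>j<N. \<Sum>l<N. residual_term n (Some (j, l)) \<omega>)" for N
    by (subst suminf_finite[of "{..<N}"]) (auto simp: a_def)
  ultimately have box_sums: "(\<lambda>N. residual_term n None \<omega> + (\<Sum>j<N. \<Sum>l<N. residual_term n (Some (j, l)) \<omega>))
      \<longlonglongrightarrow> residual_term n None \<omega> + (\<Sum>j. b j)"
    by (intro tendsto_intros) simp
  have "(\<Sum>j. b j) = real (\<Sum>j. s j) - (\<Sum>j. \<alpha> (Suc j) * real (x j))"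
    unfolding b_def using s ax by (subst suminf_diff[symmetric]) (auto simp: sums_iff)
  moreover have "residual_term n None \<omega> = real (\<epsilon> n \<omega>) - \<alpha> 0"
    by (simp add: residual_term_def centred_noise alive_def term_index_def rate_def)
  ultimately have "u n \<omega> = residual_term n None \<omega> + (\<Sum>j. b j)"
    by (simp add: INAR_residual_def X x_def)
  then show ?case
    using box_sums by (simp add: sum_index_box)
qed

section \<open>Moments and stationarity of the residuals\<close>

lemma measurable_u [measurable]: "u n \<in> borel_measurable M"
  unfolding INAR_residual_def[abs_def] by measurable

lemma residual_series:
  shows integrable_u_square: "integrable M (\<lambda>\<omega>. (u n \<omega>)\<^sup>2)"
    and expectation_u_square: "expectation (\<lambda>\<omega>. (u n \<omega>)\<^sup>2) = \<mu>"
    and expectation_u_mult_eq_0: "V \<in> borel_measurable M \<Longrightarrow> integrable M (\<lambda>\<omega>. (V \<omega>)\<^sup>2) \<Longrightarrow>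
      (\<And>i. expectation (\<lambda>\<omega>. residual_term n i \<omega> * V \<omega>) = 0) \<Longrightarrow> expectation (\<lambda>\<omega>. u n \<omega> * V \<omega>) = 0"
proof -
  note series = orthogonal_series[of "residual_term n" index_box \<mu> "u n", OF measurable_residual_term
    residual_term_square(1) _ finite_index_box incseq_index_box box_square_limit measurable_u AE_box_limit]
  show "integrable M (\<lambda>\<omega>. (u n \<omega>)\<^sup>2)"
    by (rule series(1)) (rule expectation_residual_term_mult)
  show "expectation (\<lambda>\<omega>. (u n \<omega>)\<^sup>2) = \<mu>"
    by (rule series(2)) (rule expectation_residual_term_mult)
  show "expectation (\<lambda>\<omega>. u n \<omega> * V \<omega>) = 0" if "V \<in> borel_measurable M"
    "integrable M (\<lambda>\<omega>. (V \<omega>)\<^sup>2)" "\<And>i. expectation (\<lambda>\<omega>. residual_term n i \<omega> * V \<omega>) = 0"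
    by (rule series(3)[OF _ that]) (rule expectation_residual_term_mult)
qed

lemma u_eq_past: "m < n \<Longrightarrow> u m \<omega> = INAR_residual \<alpha> (\<lambda>i x. x i) m (past n \<omega>)"
  by (simp add: INAR_residual_def past_def)

text \<open>In every term \<open>g\<close> joins the indicator in the past factor, and the centred
  noise makes the product vanish in mean. Constant \<open>g\<close> gives the mean of
  \<open>u n\<close>; the residual functional at \<open>m < n\<close> gives the covariances.\<close>

lemma expectation_u_mult_past:
  assumes g: "g \<in> borel_measurable (past_space n)" and g2: "integrable M (\<lambda>\<omega>. (g (past n \<omega>))\<^sup>2)"
  shows "expectation (\<lambda>\<omega>. u n \<omega> * g (past n \<omega>)) = 0"
proof (rule expectation_u_mult_eq_0[OF _ g2])
  show m: "(\<lambda>\<omega>. g (past n \<omega>)) \<in> borel_measurable M"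
    by (rule measurable_compose[OF measurable_past g])
  fix i
  have "(alive n i (past n \<omega>))\<^sup>2 \<le> 1" for \<omega>
    using alive_bound[of n i "past n \<omega>"] by (simp add: abs_square_le_1)
  then have "integrable M (\<lambda>\<omega>. (alive n i (past n \<omega>))\<^sup>2)"
    by (intro integrable_const_bound[where B=1]) auto
  then have int: "integrable M (\<lambda>\<omega>. alive n i (past n \<omega>) * g (past n \<omega>))"
    by (intro square_integrable_imp_integrable_mult g2 m measurable_alive_past)
  have eq: "residual_term n i \<omega> * g (past n \<omega>)
      = centred n i (noise n \<omega>) * (\<lambda>x. alive n i x * g x) (past n \<omega>)" for \<omega>
    by (simp add: residual_term_def)
  have "expectation (\<lambda>\<omega>. centred n i (noise n \<omega>) * (\<lambda>x. alive n i x * g x) (past n \<omega>))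
      = expectation (\<lambda>\<omega>. centred n i (noise n \<omega>)) * expectation (\<lambda>\<omega>. (\<lambda>x. alive n i x * g x) (past n \<omega>))"
    using has_bochner_integral_centred(1)[of n i] int g
    by (intro expectation_noise_past(2) borel_measurable_times measurable_alive measurable_centred)
       (auto simp: has_bochner_integral_iff)
  then show "expectation (\<lambda>\<omega>. residual_term n i \<omega> * g (past n \<omega>)) = 0"
    unfolding eq using has_bochner_integral_centred(1)[of n i] by (simp add: has_bochner_integral_iff)
qed

lemma integrable_u: "integrable M (u n)"
  using square_integrable_imp_integrable_mult[OF measurable_u _ integrable_u_square, of "\<lambda>_. 1" n] by simp

lemma expectation_u: "expectation (u n) = 0"
  using expectation_u_mult_past[of "\<lambda>_. 1" n] by simp

lemma integrable_u_mult: "integrable M (\<lambda>\<omega>. u n \<omega> * u m \<omega>)"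
  by (intro square_integrable_imp_integrable_mult measurable_u integrable_u_square)

lemma expectation_u_mult: "expectation (\<lambda>\<omega>. u n \<omega> * u m \<omega>) = (if n = m then \<mu> else 0)"
proof -
  have less: "expectation (\<lambda>\<omega>. u n \<omega> * u m \<omega>) = 0" if "m < n" for m n
    using expectation_u_mult_past[OF measurable_INAR_residual_eval[of \<alpha> m "{..<n}"]] integrable_u_square[of m]
    by (simp add: u_eq_past[OF that])
  show ?thesis
  proof (cases m n rule: linorder_cases)
    case greater
    then show ?thesis using less[of n m] by (simp add: mult.commute)
  qed (use less expectation_u_square[of n] in \<open>auto simp: power2_eq_square\<close>)
qed

lemma strictly_stationary_u: "strictly_stationary M borel u"
proof (rule strictly_stationary_factor[where e="\<lambda>h \<omega> i. X (i + h) \<omega>" and N="\<Pi>\<^sub>M i\<in>UNIV. count_space UNIV"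
      and F="INAR_residual \<alpha> (\<lambda>i x. x i)"])
  show "distr M (\<Pi>\<^sub>M i\<in>UNIV. count_space UNIV) (\<lambda>\<omega> i. X (i + h) \<omega>)
      = distr M (\<Pi>\<^sub>M i\<in>UNIV. count_space UNIV) (\<lambda>\<omega> i. X (i + 0) \<omega>)" for h
    using stationary by (simp add: strictly_stationary_def)
  show "(\<lambda>\<omega> i. X (i + h) \<omega>) \<in> measurable M (\<Pi>\<^sub>M i\<in>UNIV. count_space UNIV)" for h
    by (rule measurable_PiM_single') auto
  show "u (n + h) \<omega> = INAR_residual \<alpha> (\<lambda>i x. x i) n (\<lambda>i. X (i + h) \<omega>)" for n h \<omega>
    by (simp add: INAR_residual_def algebra_simps)
qed (rule measurable_INAR_residual_eval)

text \<open>Centring changes the left side by \<open>- \<mu> + K * \<mu>\<close>, which is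
  \<open>- \<alpha> 0\<close> by \<open>\<mu>_eq\<close>.\<close>

lemma AE_centred_equation:
  "AE \<omega> in M. summable (\<lambda>j. \<alpha> (Suc j) * (real (X (n - int (Suc j)) \<omega>) - \<mu>)) \<and>
    (real (X n \<omega>) - \<mu>) - (\<Sum>j. \<alpha> (Suc j) * (real (X (n - int (Suc j)) \<omega>) - \<mu>)) = u n \<omega>"
  using AE_summable_X[of n]
proof eventually_elim
  case (elim \<omega>)
  have "(\<lambda>j. \<alpha> (Suc j) * real (X (n - int (Suc j)) \<omega>) - \<alpha> (Suc j) * \<mu>)
      sums ((\<Sum>j. \<alpha> (Suc j) * real (X (n - int (Suc j)) \<omega>)) - K * \<mu>)"
    by (intro sums_diff summable_sums[OF elim] sums_mult2 sums_K)
  then have "(\<lambda>j. \<alpha> (Suc j) * (real (X (n - int (Suc j)) \<omega>) - \<mu>))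
      sums ((\<Sum>j. \<alpha> (Suc j) * real (X (n - int (Suc j)) \<omega>)) - K * \<mu>)"
    by (simp only: right_diff_distrib)
  then show ?case
    using \<mu>_eq by (auto simp: sums_iff INAR_residual_def)
qed

end

theorem proposition1:
  fixes M :: "'a measure"
    and \<alpha> :: "nat \<Rightarrow> real" and K :: real
    and \<epsilon> :: "int \<Rightarrow> 'a \<Rightarrow> nat" and \<xi> :: "int \<Rightarrow> nat \<Rightarrow> nat \<Rightarrow> 'a \<Rightarrow> nat"
    and X :: "int \<Rightarrow> 'a \<Rightarrow> nat" and u :: "int \<Rightarrow> 'a \<Rightarrow> real" and \<mu> :: real
  assumes "prob_space M"
    and "\<And>k. \<alpha> k \<ge> 0"
    and "(\<lambda>j. \<alpha> (Suc j)) sums K"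
    and "K < 1"
    and "INAR_process M \<alpha> \<epsilon> \<xi> X"
  defines "u \<equiv> INAR_residual \<alpha> X"
    and "\<mu> \<equiv> prob_space.expectation M (\<lambda>\<omega>. real (X 0 \<omega>))"
  shows "(\<forall>n. AE \<omega> in M. summable (\<lambda>j. \<alpha> (Suc j) * real (X (n - int (Suc j)) \<omega>))) \<and>
    strictly_stationary M borel u \<and>
    (\<forall>n. integrable M (u n) \<and> prob_space.expectation M (u n) = 0) \<and>
    (\<forall>n n'. integrable M (\<lambda>\<omega>. u n \<omega> * u n' \<omega>) \<and>
       prob_space.expectation M (\<lambda>\<omega>. u n \<omega> * u n' \<omega>) = (if n = n' then \<alpha> 0 / (1 - K) else 0)) \<and>
    integrable M (\<lambda>\<omega>. real (X 0 \<omega>)) \<and> \<mu> = \<alpha> 0 / (1 - K) \<and>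
    (\<forall>n. AE \<omega> in M.
       summable (\<lambda>j. \<alpha> (Suc j) * (real (X (n - int (Suc j)) \<omega>) - \<mu>)) \<and>
       (real (X n \<omega>) - \<mu>) - (\<Sum>j. \<alpha> (Suc j) * (real (X (n - int (Suc j)) \<omega>) - \<mu>)) = u n \<omega>)"
proof -
  interpret prob_space M by fact
  interpret P: inar_process M \<alpha> K \<epsilon> \<xi> X
    by unfold_locales (use assms in \<open>auto simp: INAR_process_def\<close>)
  \<comment> \<open>Here \<open>\<mu>\<close> is an expectation and \<open>P.\<mu>\<close> the
    closed form.\<close>
  have mean: "integrable M (\<lambda>\<omega>. real (X 0 \<omega>))" "\<mu> = P.\<mu>"
    using P.has_bochner_integral_X[of 0] by (auto simp: \<mu>_def has_bochner_integral_iff)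
  show ?thesis
    unfolding u_def mean(2) P.\<mu>_def[symmetric]
    by (intro conjI allI P.AE_summable_X P.strictly_stationary_u P.integrable_u P.expectation_u
        P.integrable_u_mult P.expectation_u_mult mean(1) P.AE_centred_equation refl)
qed

end
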